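(* Let $\mathcal{H}_0,\dots,\mathcal{H}_d:\mathbb{R}^{2m}\to\mathbb{R}$, let $V_l:=\mathbb{J}_{2m}^{-1}\nabla\mathcal{H}_l$ for $l=0,\dots,d$, and $V:=(V_0,\dots,V_d)$. Assume that $V$ is bounded and continuously differentiable, and that all its derivatives (of every order) are bounded. Let $Y^h_1(z)$ be the one-step numerical solution obtained by applying a symplectic method to the rough Hamiltonian system $dY_t=V_0(Y_t)dt+\sum_{l=1}^dV_l(Y_t)dX^l_t$, $Y_0=z\in\mathbb{R}^{2m}$, where the method has the expansion $$Y^h_{n+1}=Y^h_n+\sum_{|\alpha|=1}^{\infty}d_\alpha(Y^h_n)\,h^{\alpha_0}(X^1_{t_n,t_{n+1}})^{\alpha_1}\cdots(X^d_{t_n,t_{n+1}})^{\alpha_d},\qquad Y^h_0=z,$$ with $d_{e_l}=V_l$ for every $l\in\{1,\dots,d\}$, where $e_l\in\mathbb{N}^{d+1}$ is the multi-index with $\alpha_l=1$ and $|\alpha|=1$. Then the associated stochastic modified equation $$\dot{\tilde y}_t=\sum_{|\alpha|=1}^\infty f_\alpha(\tilde y_t)h^{\alpha_0-1}(X^1_{t_n,t_{n+1}})^{\alpha_1}\cdots(X^d_{t_n,t_{n+1}})^{\alpha_d},\quad t\in[t_n,t_{n+1}],\qquad \tilde y_0=z,$$ is a Hamiltonian system; that is, for every $\alpha\in\mathbb{N}^{d+1}$ with $|\alpha|\ge1$ there is a function $\mathcal{H}_\alpha:\mathbb{R}^{2m}\to\mathbb{R}$ with $f_\alpha=\mathbb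{J}_{2m}^{-1}\nabla\mathcal{H}_\alpha$.
   Context: $\mathbb{N}=\{0,1,2,\dots\}$; for $\alpha=(\alpha_0,\dots,\alpha_d)\in\mathbb{N}^{d+1}$, $|\alpha|:=\alpha_0+\cdots+\alpha_d$. A sum $\sum_{|\alpha|=1}^\infty$ runs over all multi-indices with $|\alpha|\ge1$. $\mathbb{J}_{2m}:=\begin{pmatrix}0&\mathbb{I}_m\\-\mathbb{I}_m&0\end{pmatrix}$ is the standard symplectic matrix. A one-step method is symplectic if $\left(\frac{\partial Y^h_1(z)}{\partial z}\right)^\top\mathbb{J}_{2m}\frac{\partial Y^h_1(z)}{\partial z}=\mathbb{J}_{2m}$ almost surely. Standing assumption on the noise: $X^l:[0,T]\to\mathbb{R}$, $l=1,\dots,d$, are independent centered Gaussian processes with continuous sample paths, and there exist $\rho\in[1,2)$ and $K\in(0,\infty)$ such that for all $0\le s<t\le T$ $$\sup_{\{t_k\},\{t_i\}\in\mathcal{D}([s,t])}\Big(\sum_{t_k,t_i}\big|\mathbb{E}[X^l_{t_k,t_{k+1}}X^l_{t_i,t_{i+1}}]\big|^\rho\Big)^{1/\rho}\le K|t-s|^{1/\rho},$$ where $\mathcal{D}([s,t])$ is the set of dissections of $[s,t]$ and $X^l_{s,t}:=X^l_t-X^l_s$. The equation is understood in the rough path sense (with respect to the natural Gaussian lift of $(t,X^1,\dots,X^d)$). $h=T/N$ with $N\in\mathbb{N}_+$, $t_n=nh$. The coefficient functions $d_\alpha$ do not depend on $h$ or on the values of the increments. The modified equation is in general a formal series, with $\tilde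 y$ continuous on $[0,T]$, and its coefficients are defined by the recursion $$f_\alpha=d_\alpha\ (|\alpha|=1),\qquad f_\alpha=d_\alpha-\sum_{i=2}^{|\alpha|}\frac1{i!}\sum_{(k^{i,1},\dots,k^{i,i})\in O_i}D_{k^{i,1}}\cdots D_{k^{i,i-1}}f_{k^{i,i}}\ (|\alpha|\ge2),$$ where $(D_kg)(y):=g'(y)f_k(y)$, $D_{k^{i,1}}\cdots D_{k^{i,i-1}}$ denotes composition of these operators, and $O_i$ is the set of $i$-tuples $(k^{i,1},\dots,k^{i,i})$ of multi-indices in $\mathbb{N}^{d+1}$ with $|k^{i,j}|\ge1$ and $k^{i,1}_l+\cdots+k^{i,i}_l=\alpha_l$ for $l=0,\dots,d$.
   Formalization: Added: for infinitely many N no component of the first increment X_{0,T/N} vanishes a.s. (the claim fails for X=0); the expansion is read as asymptotic for (h, increments)→0 and is assumed to hold termwise also for the Jacobian in the initial value; the d_α are assumed smooth. *)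

theory Defs
  imports "HOL-Probability.Probability" "HOL-Library.Landau_Symbols"
begin

section \<open>Smooth fields and Hamiltonian fields\<close>

definition lie_deriv ::
  "('v::euclidean_space \<Rightarrow> 'v) \<Rightarrow> ('v \<Rightarrow> 'w::real_normed_vector) \<Rightarrow> 'v \<Rightarrow> 'w" where
  "lie_deriv f g = (\<lambda>y. frechet_derivative g (at y) (f y))"

text \<open>For a list \<open>bs\<close> of basis vectors, \<open>iterated_partial bs f\<close> is the corresponding partial
  derivative of \<open>f\<close> of order \<open>length bs\<close>.\<close>

definition iterated_partial ::
  "'v list \<Rightarrow> ('v::euclidean_space \<Rightarrow> 'w::real_normed_vector) \<Rightarrow> 'v \<Rightarrow> 'w" where
  "iterated_partial bs f = foldr (\<lambda>b. lie_deriv (\<lambda>_. b)) bs f"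

definition smooth :: "('v::euclidean_space \<Rightarrow> 'w::real_normed_vector) \<Rightarrow> bool" where
  "smooth f \<longleftrightarrow> (\<forall>bs\<in>lists Basis. \<forall>x. iterated_partial bs f differentiable at x)"

text \<open>The empty list is included, so \<open>f\<close> itself is bounded.\<close>

definition bounded_smooth :: "('v::euclidean_space \<Rightarrow> 'w::real_normed_vector) \<Rightarrow> bool" where
  "bounded_smooth f \<longleftrightarrow> smooth f \<and> (\<forall>bs\<in>lists Basis. bounded (range (iterated_partial bs f)))"

text \<open>The phase space of dimension \<open>2 m\<close> is \<open>real ^ ('m + 'm)\<close>: the indices \<open>Inl _\<close> are the first
  \<open>m\<close> coordinates, the indices \<open>Inr _\<close> the last \<open>m\<close>.\<close>

definition symplectic_J :: "real ^ ('m + 'm) ^ ('m::finite + 'm)" where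
  "symplectic_J = (\<chi> i j. case (i, j) of
      (Inl a, Inr b) \<Rightarrow> if a = b then 1 else 0
    | (Inr a, Inl b) \<Rightarrow> if a = b then - 1 else 0
    | _ \<Rightarrow> 0)"

definition hamiltonian_field ::
  "(real ^ ('m + 'm) \<Rightarrow> real) \<Rightarrow> (real ^ ('m + 'm) \<Rightarrow> real ^ ('m::finite + 'm)) \<Rightarrow> bool" where
  "hamiltonian_field H v \<longleftrightarrow>
     (\<forall>y. \<exists>D. GDERIV H y :> D \<and> v y = matrix_inv symplectic_J *v D)"

definition symplectic_at ::
  "(real ^ ('m + 'm) \<Rightarrow> real ^ ('m::finite + 'm)) \<Rightarrow> real ^ ('m + 'm) \<Rightarrow> bool" where
  "symplectic_at g z \<longleftrightarrow> g differentiable at z \<and>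
     transpose (jacobian g (at z)) ** symplectic_J ** jacobian g (at z) = symplectic_J"


section \<open>Multi-indices\<close>

text \<open>The noise components are indexed by the finite type \<open>'d\<close>; in a multi-index, \<open>None\<close> is the time
  component 0 and \<open>Some l\<close> the component of noise \<open>l\<close>.\<close>

type_synonym 'd multi_index = "'d option \<Rightarrow> nat"

definition mdeg :: "'d::finite multi_index \<Rightarrow> nat" where
  "mdeg \<alpha> = (\<Sum>j\<in>UNIV. \<alpha> j)"

definition munit :: "'d option \<Rightarrow> 'd multi_index" where
  "munit j = (\<lambda>i. if i = j then 1 else 0)"

definition mpow :: "real \<Rightarrow> real ^ 'd \<Rightarrow> 'd::finite multi_index \<Rightarrow> real" where
  "mpow h x \<alpha> = h ^ \<alpha> None * (\<Prod>l\<in>UNIV. (x $ l) ^ \<alpha> (Some l))"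

text \<open>The sets \<open>O\<^sub>i\<close> of the recursion for the modified equation.\<close>

definition msplits :: "nat \<Rightarrow> 'd::finite multi_index \<Rightarrow> 'd multi_index list set" where
  "msplits i \<alpha> = {ks. length ks = i \<and> (\<forall>k\<in>set ks. 1 \<le> mdeg k) \<and> (\<forall>j. (\<Sum>k\<leftarrow>ks. k j) = \<alpha> j)}"

lemma finite_mdeg_le: "finite {\<alpha> :: 'd::finite multi_index. mdeg \<alpha> \<le> K}"
proof (rule finite_subset)
  have "\<alpha> j \<le> K" if "mdeg \<alpha> \<le> K" for \<alpha> :: "'d multi_index" and j
    using member_le_sum[of j UNIV \<alpha>] that by (simp add: mdeg_def)
  then show "{\<alpha> :: 'd multi_index. mdeg \<alpha> \<le> K} \<subseteq> (\<Pi>\<^sub>E j\<in>UNIV. {..K})"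
    by (auto simp: PiE_def)
qed (intro finite_PiE; simp)

lemma mdeg_msplits: "ks \<in> msplits i \<alpha> \<Longrightarrow> (\<Sum>k\<leftarrow>ks. mdeg k) = mdeg \<alpha>"
proof -
  assume "ks \<in> msplits i \<alpha>"
  moreover have "(\<Sum>k\<leftarrow>ks. mdeg k) = (\<Sum>j\<in>UNIV. \<Sum>k\<leftarrow>ks. k j)"
    by (induction ks) (simp_all add: mdeg_def sum.distrib)
  ultimately show ?thesis by (simp add: msplits_def mdeg_def)
qed

lemma finite_msplits: "finite (msplits i \<alpha>)"
proof (rule finite_subset)
  show "msplits i \<alpha> \<subseteq> {ks. set ks \<subseteq> {k. mdeg k \<le> mdeg \<alpha>} \<and> length ks = i}"
  proof
    fix ks assume ks: "ks \<in> msplits i \<alpha>"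
    have "mdeg k \<le> mdeg \<alpha>" if "k \<in> set ks" for k
      using member_le_sum_list[of "mdeg k" "map mdeg ks"] that mdeg_msplits[OF ks] by simp
    then show "ks \<in> {ks. set ks \<subseteq> {k. mdeg k \<le> mdeg \<alpha>} \<and> length ks = i}"
      using ks by (auto simp: msplits_def)
  qed
qed (intro finite_lists_length_eq finite_mdeg_le)

lemma mdeg_less_msplits:
  assumes "ks \<in> msplits i \<alpha>" "2 \<le> i" "k \<in> set ks"
  shows "mdeg k < mdeg \<alpha>"
proof -
  obtain xs ys where ks: "ks = xs @ k # ys" using assms(3) by (auto dest: split_list)
  have "xs @ ys \<noteq> []" using assms ks by (auto simp: msplits_def)
  then obtain k' where k': "k' \<in> set (xs @ ys)" by (cases "xs @ ys") auto
  then have "1 \<le> mdeg k'" using assms ks by (auto simp: msplits_def)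
  also have "mdeg k' \<le> (\<Sum>k\<leftarrow>xs @ ys. mdeg k)"
    using k' by (intro member_le_sum_list) auto
  finally have "1 \<le> (\<Sum>k\<leftarrow>xs @ ys. mdeg k)" .
  moreover have "mdeg \<alpha> = mdeg k + (\<Sum>k\<leftarrow>xs @ ys. mdeg k)"
    using mdeg_msplits[OF assms(1)] ks by simp
  ultimately show ?thesis by linarith
qed


section \<open>The modified equation\<close>

text \<open>For \<open>mdeg \<alpha> = 1\<close> the outer sum is empty, which gives \<open>f\<^sub>\<alpha> = d\<^sub>\<alpha>\<close>. In the composition
  \<open>D\<^bsub>k\<^sub>1\<^esub> \<dots> D\<^bsub>k\<^sub>i\<^sub>-\<^sub>1\<^esub> f\<^bsub>k\<^sub>i\<^esub>\<close> the last operator acts first.\<close>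

function modified_coeff ::
  "('d::finite multi_index \<Rightarrow> 'v \<Rightarrow> 'v::euclidean_space) \<Rightarrow> 'd multi_index \<Rightarrow> 'v \<Rightarrow> 'v" where
  "modified_coeff d \<alpha> = (\<lambda>y. d \<alpha> y -
     (\<Sum>i\<in>{2..mdeg \<alpha>}. (1 / fact i) *\<^sub>R
        (\<Sum>ks\<in>msplits i \<alpha>.
           foldr (\<lambda>k. lie_deriv (modified_coeff d k)) (butlast ks) (modified_coeff d (last ks)) y)))"
  by pat_completeness auto
termination
  by (relation "Wellfounded.measure (\<lambda>(d, \<alpha>). mdeg \<alpha>)")
     (auto dest: in_set_butlastD intro!: mdeg_less_msplits intro: last_in_set simp: msplits_def)

declare modified_coeff.simps [simp del]


section \<open>One-step methods driven by increments\<close>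

text \<open>\<open>\<Psi> h x\<close> is the one-step map for step size \<open>h\<close> and noise increments \<open>x\<close>. Neither for
  implicit methods nor for merely smooth fields does the expansion converge in general, so it is an
  asymptotic (Taylor) expansion for \<open>(h, x) \<rightarrow> 0\<close>: of the one-step map and, term by term, of its
  Jacobian with respect to the initial value, with coefficients depending on that value only and
  without any uniformity in it.\<close>

definition has_increment_expansion ::
  "(real \<Rightarrow> real ^ 'd \<Rightarrow> real ^ 'n \<Rightarrow> real ^ 'n) \<Rightarrow>
   ('d::finite multi_index \<Rightarrow> real ^ 'n \<Rightarrow> real ^ 'n::finite) \<Rightarrow> bool" where
  "has_increment_expansion \<Psi> d \<longleftrightarrow>
     (\<forall>z K. let F = at (0, 0) within {0<..} \<times> UNIV in
        (\<lambda>(h, x). norm (\<Psi> h x z -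
             (z + (\<Sum>\<alpha> | 1 \<le> mdeg \<alpha> \<and> mdeg \<alpha> \<le> K. mpow h x \<alpha> *\<^sub>R d \<alpha> z))))
          \<in> O[F](\<lambda>w. norm w ^ (K + 1)) \<and>
        (\<forall>\<^sub>F (h, x) in F. \<Psi> h x differentiable at z) \<and>
        (\<lambda>(h, x). norm (jacobian (\<Psi> h x) (at z) -
             (mat 1 + (\<Sum>\<alpha> | 1 \<le> mdeg \<alpha> \<and> mdeg \<alpha> \<le> K. mpow h x \<alpha> *\<^sub>R jacobian (d \<alpha>) (at z)))))
          \<in> O[F](\<lambda>w. norm w ^ (K + 1)))"

definition noise_increment :: "('d \<Rightarrow> real \<Rightarrow> 'a \<Rightarrow> real) \<Rightarrow> real \<Rightarrow> real \<Rightarrow> 'a \<Rightarrow> real ^ 'd::finite" where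
  "noise_increment X s t \<omega> = (\<chi> l. X l t \<omega> - X l s \<omega>)"

primrec numerical_solution ::
  "(real \<Rightarrow> real ^ 'd \<Rightarrow> 'v \<Rightarrow> 'v) \<Rightarrow> ('d::finite \<Rightarrow> real \<Rightarrow> 'a \<Rightarrow> real) \<Rightarrow> real \<Rightarrow> nat \<Rightarrow> 'v \<Rightarrow> 'a \<Rightarrow> 'v"
where
  "numerical_solution \<Psi> X h 0 z \<omega> = z"
| "numerical_solution \<Psi> X h (Suc n) z \<omega> =
     \<Psi> h (noise_increment X (real n * h) (real (Suc n) * h) \<omega>) (numerical_solution \<Psi> X h n z \<omega>)"


section \<open>Gaussian noise\<close>

text \<open>Normal with mean 0 and arbitrary variance, including variance 0.\<close>

definition centered_normal :: "'a measure \<Rightarrow> ('a \<Rightarrow> real) \<Rightarrow> bool" where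
  "centered_normal M Z \<longleftrightarrow> Z \<in> borel_measurable M \<and>
     ((AE \<omega> in M. Z \<omega> = 0) \<or> (\<exists>\<sigma>>0. distributed M lborel Z (normal_density 0 \<sigma>)))"

definition centered_gaussian_process ::
  "'a measure \<Rightarrow> real set \<Rightarrow> (real \<Rightarrow> 'a \<Rightarrow> real) \<Rightarrow> bool" where
  "centered_gaussian_process M I Z \<longleftrightarrow>
     (\<forall>S c. finite S \<and> S \<subseteq> I \<longrightarrow> centered_normal M (\<lambda>\<omega>. \<Sum>t\<in>S. c t * Z t \<omega>))"

definition dissection :: "real \<Rightarrow> real \<Rightarrow> real list \<Rightarrow> bool" where
  "dissection s t ts \<longleftrightarrow> ts \<noteq> [] \<and> sorted_wrt (<) ts \<and> hd ts = s \<and> last ts = t"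

text \<open>The supremum over pairs of dissections is spelled out as a bound for every pair.\<close>

definition covariance_rho_variation_le ::
  "'a measure \<Rightarrow> (real \<Rightarrow> 'a \<Rightarrow> real) \<Rightarrow> real \<Rightarrow> real \<Rightarrow> real \<Rightarrow> real \<Rightarrow> bool" where
  "covariance_rho_variation_le M Z \<rho> s t B \<longleftrightarrow>
     (\<forall>ps qs. dissection s t ps \<and> dissection s t qs \<longrightarrow>
        (\<Sum>k<length ps - 1. \<Sum>i<length qs - 1.
           \<bar>\<integral>\<omega>. (Z (ps ! Suc k) \<omega> - Z (ps ! k) \<omega>) * (Z (qs ! Suc i) \<omega> - Z (qs ! i) \<omega>) \<partial>M\<bar> powr \<rho>)
        powr (1 / \<rho>) \<le> B)"

definition gaussian_noise :: "'a measure \<Rightarrow> real \<Rightarrow> ('d::finite \<Rightarrow> real \<Rightarrow> 'a \<Rightarrow> real) \<Rightarrow> bool" where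
  "gaussian_noise M T X \<longleftrightarrow>
     prob_space M \<and>
     (\<forall>l. centered_gaussian_process M {0..T} (X l)) \<and>
     prob_space.indep_vars M (\<lambda>_. \<Pi>\<^sub>M t\<in>{0..T}. borel) (\<lambda>l \<omega>. \<lambda>t\<in>{0..T}. X l t \<omega>) UNIV \<and>
     (\<forall>l. \<forall>\<omega>\<in>space M. continuous_on {0..T} (\<lambda>t. X l t \<omega>)) \<and>
     (\<exists>\<rho> K. 1 \<le> \<rho> \<and> \<rho> < 2 \<and> 0 < K \<and>
        (\<forall>l s t. 0 \<le> s \<and> s < t \<and> t \<le> T \<longrightarrow>
           covariance_rho_variation_le M (X l) \<rho> s t (K * \<bar>t - s\<bar> powr (1 / \<rho>))))"

text \<open>\<open>X\<equiv>0\<close> is a Gaussian process as well, but an almost sure property of a method driven by it says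
  nothing about coefficients of the method that belong to noise increments. Hence this condition:
  for infinitely many step sizes, no component of the first increment vanishes almost surely.\<close>

definition nondegenerate_noise :: "'a measure \<Rightarrow> real \<Rightarrow> ('d::finite \<Rightarrow> real \<Rightarrow> 'a \<Rightarrow> real) \<Rightarrow> bool" where
  "nondegenerate_noise M T X \<longleftrightarrow>
     (\<exists>\<^sub>\<infinity>N. \<forall>l. \<not> (AE \<omega> in M. X l (T / real N) \<omega> - X l 0 \<omega> = 0))"

end

theory Submission
  imports Defs
begin

text \<open>
  Write \<open>f\<^sub>\<alpha>\<close> for the coefficients of the modified equation, \<open>\<omega>\<close> for the symplectic form, and
  call a vector field infinitesimally symplectic if its derivatives lie in the Lie algebra of
  \<open>\<omega>\<close>. On the simply connected phase space such a field is Hamiltonian, by the Poincare lemma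
  (\<open>infinitesimally_symplectic_imp_hamiltonian\<close>). So it is enough that every \<open>f\<^sub>\<alpha>\<close> is infinitesimally
  symplectic, and this is shown by induction on \<open>n = |\<alpha>|\<close>.

  The recursion for \<open>f\<close> says that the formal time-one flow \<open>exp(L\<^sub>F) id\<close> of the weighted sum \<open>F\<close> of the
  \<open>f\<^sub>\<alpha>\<close> is the expansion of the method. Fix \<open>h = s\<close> and increments \<open>s x\<close>, and keep in \<open>F\<close> only the terms
  of degree below \<open>n\<close>. Then the exponential, cut off after \<open>n\<close> terms, agrees with the method up to
  \<open>s\<^sup>n g + O(s\<^sup>n\<^sup>+\<^sup>1)\<close>, where \<open>g\<close> is the sum of the \<open>x\<^sup>\<alpha> f\<^sub>\<alpha>\<close> over \<open>|\<alpha>| = n\<close>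
  (\<open>truncated_exp_expansion\<close>). By induction \<open>F\<close> is infinitesimally symplectic, so its exponential
  preserves \<open>\<omega>\<close> order by order. The proof of this is purely algebraic: the pullbacks of \<open>\<omega>\<close> satisfy a
  Leibniz rule, and the constant form is annihilated by the Lie derivative along \<open>F\<close>
  (\<open>exp_terms_preserve_form\<close>). If the method preserves \<open>\<omega>\<close> up to \<open>O(s\<^sup>n\<^sup>+\<^sup>1)\<close> as well, comparison of the
  two sides leaves \<open>\<omega>(g' u, v) + \<omega>(u, g' v) = 0\<close> (\<open>modified_coeff_leading_defect\<close>). This holds for
  all \<open>x\<close>, hence for each coefficient of this polynomial in \<open>x\<close>, that is, for every \<open>f\<^sub>\<alpha>\<close> with
  \<open>|\<alpha>| = n\<close>.

  It remains to pass from an almost sure property to one that holds for every \<open>x\<close>. By independence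
  and nondegeneracy, the first increments hit every open set with positive probability, for
  infinitely many step sizes (\<open>increments_hit_open_sets\<close>). The truncated expansion is a polynomial in
  the increments, so its defect, being \<open>O(|(h, x)|\<^sup>n\<^sup>+\<^sup>1)\<close> for a dense set of \<open>x\<close>, satisfies this bound
  for all \<open>x\<close>. The step sizes accumulate at 0, which suffices for the comparison of leading terms.
\<close>

section \<open>Smooth maps\<close>

lemma frechet_derivative_eqI: "(g has_derivative g') (at y) \<Longrightarrow> frechet_derivative g (at y) = g'"
  by (metis frechet_derivative_at)

lemma smooth_differentiable: "smooth f \<Longrightarrow> f differentiable at x"
  unfolding smooth_def iterated_partial_def by (auto dest!: bspec[of _ _ "[]"])

lemma smooth_partial:
  assumes "smooth f" "b \<in> Basis"
  shows "smooth (lie_deriv (\<lambda>_. b) f)"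
  unfolding smooth_def
proof (intro ballI allI)
  fix bs x assume "bs \<in> lists (Basis :: 'a set)"
  then have "bs @ [b] \<in> lists Basis" using assms by auto
  then have "iterated_partial (bs @ [b]) f differentiable at x"
    using assms unfolding smooth_def by blast
  then show "iterated_partial bs (lie_deriv (\<lambda>_. b) f) differentiable at x"
    by (simp add: iterated_partial_def)
qed

text \<open>Smoothness is the largest property of maps that implies differentiability and passes to the partial
  derivatives. This principle makes every closure property below a one-step verification.\<close>

lemma smooth_coinduct:
  assumes "P f"
    and step: "\<And>g. P g \<Longrightarrow> (\<forall>x. g differentiable at x) \<and> (\<forall>b\<in>Basis. P (lie_deriv (\<lambda>_. b) g))"
  shows "smooth f"
  unfolding smooth_def
proof (intro ballI allI)
  fix bs x assume "bs \<in> lists (Basis :: 'a set)"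
  then show "iterated_partial bs f differentiable at x" using \<open>P f\<close>
  proof (induction bs arbitrary: f rule: rev_induct)
    case Nil
    then show ?case using step by (simp add: iterated_partial_def)
  next
    case (snoc b bs)
    then have "iterated_partial bs (lie_deriv (\<lambda>_. b) f) differentiable at x"
      using step[of f] by (intro snoc.IH) auto
    then show ?case by (simp add: iterated_partial_def)
  qed
qed

lemma smooth_const:
  fixes c :: "'w::real_normed_vector"
  shows "smooth (\<lambda>_ :: 'v::euclidean_space. c)"
proof (rule smooth_coinduct[where P = "\<lambda>g. \<exists>d. g = (\<lambda>_. d)"])
  show "\<exists>d. (\<lambda>_::'v. c) = (\<lambda>_. d)" by auto
next
  fix g :: "'v \<Rightarrow> 'w" assume "\<exists>d. g = (\<lambda>_. d)"
  then obtain d where g: "g = (\<lambda>_. d)" by auto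
  show "(\<forall>x. g differentiable at x) \<and> (\<forall>b\<in>Basis. \<exists>d. lie_deriv (\<lambda>_. b) g = (\<lambda>_. d))"
    unfolding g by (auto simp: lie_deriv_def)
qed

text \<open>Products of smooth maps alone do not form a class to which the coinduction principle applies, since
  the partial derivative of a product is a sum of two products. The finite sums of products do.\<close>

inductive smooth_span :: "('v::euclidean_space \<Rightarrow> 'w::real_normed_vector) \<Rightarrow> bool" where
  mult: "smooth u \<Longrightarrow> smooth g \<Longrightarrow> smooth_span (\<lambda>y. u y *\<^sub>R g y)"
| add: "smooth_span p \<Longrightarrow> smooth_span q \<Longrightarrow> smooth_span (\<lambda>y. p y + q y)"

lemma smooth_smooth_span:
  assumes "smooth_span f" shows "smooth f"
proof (rule smooth_coinduct[where P = smooth_span, OF assms])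
  fix g :: "'a \<Rightarrow> 'b" assume "smooth_span g"
  then show "(\<forall>x. g differentiable at x) \<and> (\<forall>b\<in>Basis. smooth_span (lie_deriv (\<lambda>_. b) g))"
  proof induction
    case (mult u g)
    note D = mult[THEN smooth_differentiable]
    have "lie_deriv (\<lambda>_. b) (\<lambda>y. u y *\<^sub>R g y) =
        (\<lambda>y. u y *\<^sub>R lie_deriv (\<lambda>_. b) g y + lie_deriv (\<lambda>_. b) u y *\<^sub>R g y)" for b
    proof
      fix y
      have "((\<lambda>y. u y *\<^sub>R g y) has_derivative
          (\<lambda>h. u y *\<^sub>R frechet_derivative g (at y) h + frechet_derivative u (at y) h *\<^sub>R g y)) (at y)"
        using D by (intro has_derivative_scaleR) (auto simp: frechet_derivative_works)
      then show "lie_deriv (\<lambda>_. b) (\<lambda>y. u y *\<^sub>R g y) y =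
        u y *\<^sub>R lie_deriv (\<lambda>_. b) g y + lie_deriv (\<lambda>_. b) u y *\<^sub>R g y"
        by (simp add: lie_deriv_def frechet_derivative_eqI)
    qed
    then show ?case using D mult
      by (auto intro!: smooth_span.add smooth_span.mult smooth_partial differentiable_scaleR)
  next
    case (add p q)
    then have "lie_deriv (\<lambda>_. b) (\<lambda>y. p y + q y) =
        (\<lambda>y. lie_deriv (\<lambda>_. b) p y + lie_deriv (\<lambda>_. b) q y)" for b
      by (auto simp: lie_deriv_def frechet_derivative_works
          intro!: frechet_derivative_eqI[THEN fun_cong, OF has_derivative_add])
    then show ?case using add by (auto intro!: smooth_span.add differentiable_add)
  qed
qed

lemma smooth_scaleR: "smooth u \<Longrightarrow> smooth g \<Longrightarrow> smooth (\<lambda>y. u y *\<^sub>R g y)"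
  by (rule smooth_smooth_span[OF smooth_span.mult])

lemma smooth_add:
  assumes "smooth f" "smooth g" shows "smooth (\<lambda>y. f y + g y)"
proof -
  have "smooth_span (\<lambda>y. 1 *\<^sub>R f y)" "smooth_span (\<lambda>y. 1 *\<^sub>R g y)"
    using assms by (auto simp del: scaleR_one intro!: smooth_span.mult smooth_const)
  then show ?thesis
    using smooth_smooth_span[OF smooth_span.add[of f g]] by simp
qed

lemma smooth_sum: "(\<And>i. i \<in> I \<Longrightarrow> smooth (f i)) \<Longrightarrow> smooth (\<lambda>y. \<Sum>i\<in>I. f i y)"
  by (induction I rule: infinite_finite_induct) (simp_all add: smooth_const smooth_add)

lemma smooth_diff: "smooth f \<Longrightarrow> smooth g \<Longrightarrow> smooth (\<lambda>y. f y - g y)"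
  using smooth_add[of f "\<lambda>y. (-1) *\<^sub>R g y"] smooth_scaleR[OF smooth_const[of "-1"], of g] by simp

lemma smooth_linear_comp:
  assumes A: "bounded_linear A" and "smooth f"
  shows "smooth (\<lambda>y. A (f y))"
proof (rule smooth_coinduct[where P = "\<lambda>g. \<exists>f. smooth f \<and> g = (\<lambda>y. A (f y))"])
  fix g assume "\<exists>f. smooth f \<and> g = (\<lambda>y. A (f y))"
  then obtain f where f: "smooth f" "g = (\<lambda>y. A (f y))" by auto
  have D: "(g has_derivative (\<lambda>h. A (frechet_derivative f (at y) h))) (at y)" for y
    unfolding f(2) using smooth_differentiable[OF f(1), of y]
    by (intro bounded_linear.has_derivative[OF A]) (simp add: frechet_derivative_works)
  have "lie_deriv (\<lambda>_. b) g = (\<lambda>y. A (lie_deriv (\<lambda>_. b) f y))" for b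
    by (simp add: lie_deriv_def frechet_derivative_eqI[OF D])
  then show "(\<forall>x. g differentiable at x) \<and>
      (\<forall>b\<in>Basis. \<exists>f. smooth f \<and> lie_deriv (\<lambda>_. b) g = (\<lambda>y. A (f y)))"
    using D smooth_partial[OF f(1)] unfolding differentiable_def by blast
qed (use assms in auto)

lemma smooth_id: "smooth (\<lambda>y. y)"
proof (rule smooth_coinduct[where P = "\<lambda>g. g = (\<lambda>y. y) \<or> smooth g"])
  fix g :: "'a \<Rightarrow> 'a" assume g: "g = (\<lambda>y. y) \<or> smooth g"
  have "lie_deriv (\<lambda>_. b) (\<lambda>y. y) = (\<lambda>_. b)" for b :: 'a
    by (auto simp: lie_deriv_def frechet_derivative_eqI[OF has_derivative_ident])
  then show "(\<forall>x. g differentiable at x) \<and>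
      (\<forall>b\<in>Basis. lie_deriv (\<lambda>_. b) g = (\<lambda>y. y) \<or> smooth (lie_deriv (\<lambda>_. b) g))"
    using g by (auto simp: smooth_const smooth_differentiable smooth_partial)
qed auto

text \<open>Expanding \<open>f y\<close> in the standard basis turns a Lie derivative along a variable field into
  products of smooth functions with partial derivatives along constant fields.\<close>

lemma lie_deriv_eq_sum_partials:
  assumes "g differentiable at y"
  shows "lie_deriv f g y = (\<Sum>b\<in>Basis. (f y \<bullet> b) *\<^sub>R lie_deriv (\<lambda>_. b) g y)"
proof -
  interpret linear "frechet_derivative g (at y)"
    using assms by (rule linear_frechet_derivative)
  have "frechet_derivative g (at y) (\<Sum>b\<in>Basis. (f y \<bullet> b) *\<^sub>R b) =
      (\<Sum>b\<in>Basis. (f y \<bullet> b) *\<^sub>R frechet_derivative g (at y) b)"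
    by (simp add: sum scaleR)
  then show ?thesis by (simp add: lie_deriv_def euclidean_representation)
qed

lemma smooth_lie_deriv:
  assumes "smooth f" "smooth g" shows "smooth (lie_deriv f g)"
proof -
  have "lie_deriv f g = (\<lambda>y. \<Sum>b\<in>Basis. (f y \<bullet> b) *\<^sub>R lie_deriv (\<lambda>_. b) g y)"
    using lie_deriv_eq_sum_partials smooth_differentiable[OF assms(2)] by blast
  then show ?thesis
    by (simp add: assms smooth_sum smooth_scaleR smooth_partial
        smooth_linear_comp[OF bounded_linear_inner_left])
qed

lemma smooth_continuous_on: "smooth f \<Longrightarrow> continuous_on A f"
  by (meson smooth_differentiable differentiable_imp_continuous_within continuous_at_imp_continuous_on)

lemma smooth_continuous_on_compose:
  "smooth f \<Longrightarrow> continuous_on A p \<Longrightarrow> continuous_on A (\<lambda>x. f (p x))"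
  using continuous_on_compose2[OF smooth_continuous_on] by blast

lemma smooth_has_derivative: "smooth f \<Longrightarrow> (f has_derivative frechet_derivative f (at x)) (at x)"
  using smooth_differentiable frechet_derivative_works by blast

section \<open>Symmetry of second derivatives and gradients\<close>

lemma smooth_line_derivative:
  assumes "smooth g"
  shows "((\<lambda>t. g (x + t *\<^sub>R u)) has_vector_derivative lie_deriv (\<lambda>_. u) g (x + t *\<^sub>R u)) (at t within S)"
proof -
  interpret linear "frechet_derivative g (at (x + t *\<^sub>R u))"
    using smooth_differentiable[OF assms] by (rule linear_frechet_derivative)
  have "((\<lambda>t. x + t *\<^sub>R u) has_derivative (\<lambda>h. h *\<^sub>R u)) (at t within S)"
    by (auto intro!: derivative_eq_intros)
  from has_derivative_compose[OF this smooth_has_derivative[OF assms]]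
  show ?thesis by (simp add: has_vector_derivative_def lie_deriv_def scaleR)
qed

lemma smooth_increment_eq_integral:
  fixes g :: "'v::euclidean_space \<Rightarrow> 'w::euclidean_space"
  assumes "smooth g" "0 \<le> s"
  shows "integral {0..s} (\<lambda>t. lie_deriv (\<lambda>_. u) g (x + t *\<^sub>R u)) = g (x + s *\<^sub>R u) - g x"
  using fundamental_theorem_of_calculus[OF assms(2) smooth_line_derivative[OF assms(1)]]
  by (simp add: integral_unique)

text \<open>The increment of \<open>g\<close> in direction \<open>u\<close> is the integral of its derivative in direction \<open>u\<close>. Differentiating
  under the integral sign in direction \<open>v\<close>, and then with respect to the length of the increment at 0,
  exchanges the two derivatives.\<close>

lemma mixed_partials:
  fixes g :: "'v::euclidean_space \<Rightarrow> 'w::euclidean_space"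
  assumes g: "smooth g"
  shows "lie_deriv (\<lambda>_. u) (lie_deriv (\<lambda>_. v) g) x = lie_deriv (\<lambda>_. v) (lie_deriv (\<lambda>_. u) g) x"
proof -
  define gu where "gu = lie_deriv (\<lambda>_. u) g"
  define gv where "gv = lie_deriv (\<lambda>_. v) g"
  define guv where "guv = lie_deriv (\<lambda>_. v) gu"
  have sm: "smooth gu" "smooth gv" "smooth guv"
    unfolding gu_def gv_def guv_def by (intro smooth_lie_deriv smooth_const g)+
  note cont = sm[THEN smooth_continuous_on_compose]
  \<comment> \<open>Both sides are the derivative at \<open>t = 0\<close> of the increment of \<open>g\<close> from \<open>x + t v\<close> to \<open>x + t v + s u\<close>.\<close>
  have eq: "gv (x + s *\<^sub>R u) - gv x = integral {0..s} (\<lambda>r. guv (x + r *\<^sub>R u))" if s: "s \<in> {0..1}" for s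
  proof (rule vector_derivative_unique_at)
    let ?F = "\<lambda>t. g ((x + s *\<^sub>R u) + t *\<^sub>R v) - g (x + t *\<^sub>R v)"
    show "(?F has_vector_derivative gv (x + s *\<^sub>R u) - gv x) (at 0)"
      using smooth_line_derivative[OF g, of "x + s *\<^sub>R u" v 0 UNIV]
        smooth_line_derivative[OF g, of x v 0 UNIV]
      unfolding gv_def by (auto intro: has_vector_derivative_diff)
    have F: "?F = (\<lambda>t. integral (cbox 0 s) (\<lambda>r. gu (x + r *\<^sub>R u + t *\<^sub>R v)))"
    proof
      fix t
      show "?F t = integral (cbox 0 s) (\<lambda>r. gu (x + r *\<^sub>R u + t *\<^sub>R v))"
        using smooth_increment_eq_integral[OF g, of s u "x + t *\<^sub>R v"] s
        by (simp add: gu_def algebra_simps)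
    qed
    have "(?F has_vector_derivative integral (cbox 0 s) (\<lambda>r. guv (x + r *\<^sub>R u + 0 *\<^sub>R v))) (at 0)"
      unfolding F
    proof (rule leibniz_rule_vector_derivative[where U = UNIV])
      show "((\<lambda>t. gu (x + r *\<^sub>R u + t *\<^sub>R v)) has_vector_derivative guv (x + r *\<^sub>R u + t *\<^sub>R v)) (at t)" for r t
        using smooth_line_derivative[OF sm(1), of "x + r *\<^sub>R u" v t UNIV] by (simp add: guv_def)
      show "(\<lambda>r. gu (x + r *\<^sub>R u + t *\<^sub>R v)) integrable_on cbox 0 s" for t
        by (intro integrable_continuous cont continuous_intros)
      show "continuous_on (UNIV \<times> cbox 0 s) (\<lambda>(t, r). guv (x + r *\<^sub>R u + t *\<^sub>R v))"
        unfolding split_beta by (intro cont continuous_intros)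
    qed auto
    then show "(?F has_vector_derivative integral {0..s} (\<lambda>r. guv (x + r *\<^sub>R u))) (at 0)"
      by simp
  qed
  have "lie_deriv (\<lambda>_. u) gv x = guv x"
  proof (rule vector_derivative_unique_within)
    show "at 0 within {0..1::real} \<noteq> bot"
      by (simp add: at_within_Icc_at_right)
    show "((\<lambda>s. gv (x + s *\<^sub>R u) - gv x) has_vector_derivative lie_deriv (\<lambda>_. u) gv x) (at 0 within {0..1})"
      using has_vector_derivative_diff[OF smooth_line_derivative[OF sm(2), of x u 0 "{0..1}"]
          has_vector_derivative_const[of "gv x"]] by simp
    have "((\<lambda>s. integral {0..s} (\<lambda>r. guv (x + r *\<^sub>R u))) has_vector_derivative guv (x + 0 *\<^sub>R u))
        (at 0 within {0..1})"
      by (rule integral_has_vector_derivative) (auto intro!: cont continuous_intros)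
    then have "((\<lambda>s. integral {0..s} (\<lambda>r. guv (x + r *\<^sub>R u))) has_vector_derivative guv x) (at 0 within {0..1})"
      by simp
    then show "((\<lambda>s. gv (x + s *\<^sub>R u) - gv x) has_vector_derivative guv x) (at 0 within {0..1})"
      by (rule has_vector_derivative_transform[rotated 2]) (auto simp: eq)
  qed
  then show ?thesis by (simp add: gu_def gv_def guv_def)
qed

text \<open>The product rule gives one term in which the field is differentiated and one with a second derivative
  of \<open>g\<close>; by the symmetry of the latter it is again a Lie derivative along \<open>f\<close>. This is how the Jacobians
  of the terms of an exponential series are propagated.\<close>

lemma derivative_lie_deriv:
  fixes g :: "'v::euclidean_space \<Rightarrow> 'w::euclidean_space"
  assumes f: "smooth f" and g: "smooth g"
  shows "lie_deriv (\<lambda>_. u) (lie_deriv f g) y =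
    lie_deriv f (lie_deriv (\<lambda>_. u) g) y + frechet_derivative g (at y) (frechet_derivative f (at y) u)"
proof -
  define f' where "f' = frechet_derivative f (at y)"
  define gb where "gb = (\<lambda>b. lie_deriv (\<lambda>_. b) g)"
  have gb: "smooth (gb b)" for b
    unfolding gb_def by (intro smooth_lie_deriv smooth_const g)
  have "lie_deriv f g = (\<lambda>y. \<Sum>b\<in>Basis. (f y \<bullet> b) *\<^sub>R gb b y)"
    unfolding gb_def using lie_deriv_eq_sum_partials smooth_differentiable[OF g] by blast
  moreover have "((\<lambda>y. \<Sum>b\<in>Basis. (f y \<bullet> b) *\<^sub>R gb b y) has_derivative
      (\<lambda>h. \<Sum>b\<in>Basis. (f y \<bullet> b) *\<^sub>R frechet_derivative (gb b) (at y) h + (f' h \<bullet> b) *\<^sub>R gb b y)) (at y)"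
    unfolding f'_def
    by (intro has_derivative_sum has_derivative_scaleR has_derivative_inner_left
        smooth_has_derivative gb f)
  ultimately have "lie_deriv (\<lambda>_. u) (lie_deriv f g) y =
      (\<Sum>b\<in>Basis. (f y \<bullet> b) *\<^sub>R lie_deriv (\<lambda>_. u) (gb b) y) + (\<Sum>b\<in>Basis. (f' u \<bullet> b) *\<^sub>R gb b y)"
    by (simp add: lie_deriv_def frechet_derivative_eqI sum.distrib)
  also have "(\<Sum>b\<in>Basis. (f y \<bullet> b) *\<^sub>R lie_deriv (\<lambda>_. u) (gb b) y) = lie_deriv f (lie_deriv (\<lambda>_. u) g) y"
    unfolding gb_def mixed_partials[OF g, of u]
    by (rule lie_deriv_eq_sum_partials[symmetric])
       (intro smooth_differentiable smooth_lie_deriv smooth_const g)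
  also have "(\<Sum>b\<in>Basis. (f' u \<bullet> b) *\<^sub>R gb b y) = frechet_derivative g (at y) (f' u)"
    using lie_deriv_eq_sum_partials[OF smooth_differentiable[OF g], of "\<lambda>_. f' u" y]
    by (simp add: gb_def) (simp add: lie_deriv_def)
  finally show ?thesis by (simp add: f'_def)
qed

text \<open>The Poincare lemma for 1-forms, with the potential \<open>H y\<close> given by the integral of \<open>G\<close> along the segment
  from 0 to \<open>y\<close>. By the symmetry of the derivative, the derivative of the integrand in direction \<open>v\<close> is
  the \<open>t\<close>-derivative of \<open>t (G (t y) \<bullet> v)\<close>, whose integral over the unit interval is \<open>G y \<bullet> v\<close>.\<close>

lemma symmetric_derivative_imp_gradient:
  fixes G :: "'v::euclidean_space \<Rightarrow> 'v"
  assumes G: "smooth G"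
    and sym: "\<And>y u v. frechet_derivative G (at y) u \<bullet> v = u \<bullet> frechet_derivative G (at y) v"
  shows "\<exists>H. \<forall>y. GDERIV H y :> G y"
proof (intro exI allI)
  fix y :: 'v
  define G' where "G' = (\<lambda>y. frechet_derivative G (at y))"
  have G': "(G has_derivative G' z) (at z)" for z
    unfolding G'_def by (rule smooth_has_derivative[OF G])
  define K where "K = (\<lambda>x t. Blinfun (\<lambda>v. t * (G' (t *\<^sub>R x) v \<bullet> x) + G (t *\<^sub>R x) \<bullet> v))"
  have D: "((\<lambda>x. G (t *\<^sub>R x) \<bullet> x) has_derivative (\<lambda>v. t * (G' (t *\<^sub>R x) v \<bullet> x) + G (t *\<^sub>R x) \<bullet> v)) (at x)"
    for x t
  proof -
    have "linear (G' (t *\<^sub>R x))" using G' has_derivative_linear by blast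
    then have lin: "G' (t *\<^sub>R x) (t *\<^sub>R h) = t *\<^sub>R G' (t *\<^sub>R x) h" for h by (simp add: linear_cmul)
    have "((\<lambda>x. G (t *\<^sub>R x)) has_derivative (\<lambda>h. G' (t *\<^sub>R x) (t *\<^sub>R h))) (at x)"
      by (rule has_derivative_compose[OF _ G']) (auto intro!: derivative_eq_intros)
    then have "((\<lambda>x. G (t *\<^sub>R x) \<bullet> x) has_derivative
        (\<lambda>h. G (t *\<^sub>R x) \<bullet> h + G' (t *\<^sub>R x) (t *\<^sub>R h) \<bullet> x)) (at x)"
      by (intro has_derivative_inner) auto
    then show ?thesis by (simp add: lin add.commute)
  qed
  have K: "blinfun_apply (K x t) = (\<lambda>v. t * (G' (t *\<^sub>R x) v \<bullet> x) + G (t *\<^sub>R x) \<bullet> v)" for x t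
    unfolding K_def using D has_derivative_bounded_linear by (intro bounded_linear_Blinfun_apply) blast
  have cont_G': "continuous_on A (\<lambda>x. G' (p x) b)" if "continuous_on A p" for A b and p :: "'c::t2_space \<Rightarrow> 'v"
    using smooth_continuous_on_compose[OF smooth_lie_deriv[OF smooth_const[of b] G] that]
    by (simp add: lie_deriv_def G'_def)
  have cont_K: "continuous_on A (\<lambda>(x, t). K x t)" for A
    by (rule continuous_on_blinfun_componentwise)
       (auto simp: split_beta K intro!: continuous_intros cont_G' smooth_continuous_on_compose[OF G])
  have int_K: "K y integrable_on cbox 0 1"
  proof (rule integrable_continuous)
    have "continuous_on (cbox 0 1) (\<lambda>t::real. (y, t))"
      by (intro continuous_intros)
    from continuous_on_compose2[OF cont_K[of UNIV] this] show "continuous_on (cbox 0 1) (K y)"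
      by simp
  qed
  have "((\<lambda>x. integral (cbox 0 1) (\<lambda>t. G (t *\<^sub>R x) \<bullet> x)) has_derivative
      blinfun_apply (integral (cbox 0 1) (K y))) (at y)"
    by (rule leibniz_rule[where U = UNIV])
       (auto simp: K D cont_K intro!: integrable_continuous_real continuous_intros
         smooth_continuous_on_compose[OF G])
  moreover have "blinfun_apply (integral (cbox 0 1) (K y)) = (\<lambda>v. v \<bullet> G y)"
  proof
    fix v
    have "((\<lambda>t. K y t v) has_integral 1 * (G (0 + 1 *\<^sub>R y) \<bullet> v) - 0 * (G (0 + 0 *\<^sub>R y) \<bullet> v)) {0..1}"
    proof (rule fundamental_theorem_of_calculus)
      fix t :: real
      have "((\<lambda>t. t * (G (0 + t *\<^sub>R y) \<bullet> v)) has_vector_derivative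
          t * (lie_deriv (\<lambda>_. y) G (0 + t *\<^sub>R y) \<bullet> v) + 1 * (G (0 + t *\<^sub>R y) \<bullet> v)) (at t within {0..1})"
        by (intro has_vector_derivative_mult has_vector_derivative_id smooth_line_derivative G
            bounded_linear.has_vector_derivative[OF bounded_linear_inner_left])
      moreover have "G' (t *\<^sub>R y) y \<bullet> v = G' (t *\<^sub>R y) v \<bullet> y"
        unfolding G'_def by (metis sym inner_commute)
      ultimately show "((\<lambda>t. t * (G (0 + t *\<^sub>R y) \<bullet> v)) has_vector_derivative K y t v) (at t within {0..1})"
        by (simp add: K lie_deriv_def G'_def)
    qed simp
    then show "blinfun_apply (integral (cbox 0 1) (K y)) v = v \<bullet> G y"
      using int_K by (simp add: blinfun_apply_integral integral_unique inner_commute)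
  qed
  ultimately show "GDERIV (\<lambda>x. integral (cbox 0 1) (\<lambda>t. G (t *\<^sub>R x) \<bullet> x)) y :> G y"
    by (simp add: gderiv_def)
qed

section \<open>Exponentials of infinitesimally symplectic fields\<close>

text \<open>For \<open>\<omega>(u, v) = u \<bullet> J v\<close> this is the identity \<open>A\<^sup>T J + J A = 0\<close> for the Jacobians \<open>A\<close> of \<open>f\<close>, that is,
  the Lie derivative of the constant form \<open>\<omega>\<close> along \<open>f\<close> vanishes.\<close>

definition infinitesimally_symplectic ::
  "('v \<Rightarrow> 'v \<Rightarrow> real) \<Rightarrow> ('v::euclidean_space \<Rightarrow> 'v) \<Rightarrow> bool" where
  "infinitesimally_symplectic \<omega> f \<longleftrightarrow>
     (\<forall>y u v. \<omega> (frechet_derivative f (at y) u) v + \<omega> u (frechet_derivative f (at y) v) = 0)"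

text \<open>The \<open>i\<close>-th term of the Lie series \<open>exp(L\<^sub>F) id\<close> for the time-one flow of \<open>F\<close>.\<close>

definition exp_term :: "('v::euclidean_space \<Rightarrow> 'v) \<Rightarrow> nat \<Rightarrow> 'v \<Rightarrow> 'v" where
  "exp_term F i = (\<lambda>y. (1 / fact i) *\<^sub>R (lie_deriv F ^^ i) (\<lambda>y. y) y)"

lemma smooth_lie_power: "smooth F \<Longrightarrow> smooth ((lie_deriv F ^^ i) (\<lambda>y. y))"
  by (induction i) (auto intro: smooth_lie_deriv smooth_id)

lemma smooth_exp_term: "smooth F \<Longrightarrow> smooth (exp_term F i)"
  unfolding exp_term_def by (intro smooth_scaleR smooth_const smooth_lie_power)

lemma lie_deriv_scaleR:
  "g differentiable at y \<Longrightarrow> lie_deriv f (\<lambda>y. c *\<^sub>R g y) y = c *\<^sub>R lie_deriv f g y"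
  by (simp add: lie_deriv_def frechet_derivative_works
      frechet_derivative_eqI[THEN fun_cong, OF has_derivative_scaleR_right])

lemma lie_deriv_sum:
  assumes "\<And>i. i \<in> I \<Longrightarrow> g i differentiable at y"
  shows "lie_deriv f (\<lambda>y. \<Sum>i\<in>I. g i y) y = (\<Sum>i\<in>I. lie_deriv f (g i) y)"
proof -
  have "((\<lambda>y. \<Sum>i\<in>I. g i y) has_derivative (\<lambda>h. \<Sum>i\<in>I. frechet_derivative (g i) (at y) h)) (at y)"
    using assms by (intro has_derivative_sum) (simp add: frechet_derivative_works)
  then show ?thesis by (simp add: lie_deriv_def frechet_derivative_eqI)
qed

lemma lie_deriv_add:
  assumes "f differentiable at y" "g differentiable at y"
  shows "lie_deriv h (\<lambda>y. f y + g y) y = lie_deriv h f y + lie_deriv h g y"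
  using assms by (simp add: lie_deriv_def frechet_derivative_works
      frechet_derivative_eqI[THEN fun_cong, OF has_derivative_add])

lemma lie_deriv_const: "lie_deriv f (\<lambda>_. c) = (\<lambda>_. 0)"
  by (auto simp: lie_deriv_def)

lemma lie_deriv_ident: "lie_deriv f (\<lambda>y. y) = f"
  by (auto simp: lie_deriv_def frechet_derivative_eqI[OF has_derivative_ident])

lemma exp_term_Suc:
  assumes "smooth F"
  shows "real (Suc i) *\<^sub>R exp_term F (Suc i) y = lie_deriv F (exp_term F i) y"
  using smooth_differentiable[OF smooth_lie_power[OF assms]]
  by (simp add: exp_term_def lie_deriv_scaleR del: of_nat_Suc)

lemma lie_deriv_bilinear:
  assumes "bounded_bilinear \<omega>" "p differentiable at y" "q differentiable at y"
  shows "lie_deriv f (\<lambda>y. \<omega> (p y) (q y)) y = \<omega> (lie_deriv f p y) (q y) + \<omega> (p y) (lie_deriv f q y)"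
proof -
  have "((\<lambda>y. \<omega> (p y) (q y)) has_derivative (\<lambda>h. \<omega> (p y) (frechet_derivative q (at y) h)
      + \<omega> (frechet_derivative p (at y) h) (q y))) (at y)"
    using assms by (intro bounded_bilinear.FDERIV) (auto simp: frechet_derivative_works)
  then show ?thesis by (simp add: lie_deriv_def frechet_derivative_eqI)
qed

text \<open>Let \<open>S p\<close> be the bilinear form on the left, which is the homogeneous part of order \<open>p\<close> of the pullback of
  \<open>\<omega>\<close> by the Lie series. The Jacobians of the terms satisfy
  \<open>(i + 1) e\<^bsub>i + 1\<^esub>' u = L\<^sub>F (e\<^sub>i' u) + e\<^sub>i' (F' u)\<close>, so the Leibniz rule gives
  \<open>(p + 1) S (p + 1) = L\<^sub>F (S p)\<close>, where the Lie derivative is that of bilinear forms. Since \<open>S 0 = \<omega>\<close> and \<open>L\<^sub>F \<omega> = 0\<close>,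
  all further terms vanish.\<close>

lemma exp_terms_preserve_form:
  fixes F :: "'v::euclidean_space \<Rightarrow> 'v" and \<omega> :: "'v \<Rightarrow> 'v \<Rightarrow> real"
  assumes \<omega>: "bounded_bilinear \<omega>" and F: "smooth F" and symp: "infinitesimally_symplectic \<omega> F"
  shows "(\<Sum>i\<le>p. \<omega> (lie_deriv (\<lambda>_. u) (exp_term F i) y) (lie_deriv (\<lambda>_. v) (exp_term F (p - i)) y)) =
    (if p = 0 then \<omega> u v else 0)"
proof (induction p arbitrary: u v y)
  case 0
  have "exp_term F 0 = (\<lambda>y. y)" by (simp add: exp_term_def)
  then show ?case by (simp add: lie_deriv_ident)
next
  case (Suc p)
  interpret bounded_bilinear \<omega> by fact
  define e where "e = exp_term F"
  define S where "S = (\<lambda>p y u v. \<Sum>i\<le>p. \<omega> (lie_deriv (\<lambda>_. u) (e i) y) (lie_deriv (\<lambda>_. v) (e (p - i)) y))"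
  define F' where "F' = frechet_derivative F (at y)"
  have e: "smooth (e i)" for i unfolding e_def by (rule smooth_exp_term[OF F])
  have de: "smooth (lie_deriv (\<lambda>_. u) (e i))" for u i by (intro smooth_lie_deriv smooth_const e)
  have step: "real (Suc i) *\<^sub>R lie_deriv (\<lambda>_. u) (e (Suc i)) y =
      lie_deriv F (lie_deriv (\<lambda>_. u) (e i)) y + lie_deriv (\<lambda>_. F' u) (e i) y" for u i
  proof -
    have "(\<lambda>y. real (Suc i) *\<^sub>R e (Suc i) y) = lie_deriv F (e i)"
      using exp_term_Suc[OF F] by (auto simp: e_def)
    then have "real (Suc i) *\<^sub>R lie_deriv (\<lambda>_. u) (e (Suc i)) y = lie_deriv (\<lambda>_. u) (lie_deriv F (e i)) y"
      using lie_deriv_scaleR[OF smooth_differentiable[OF e]] by metis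
    then show ?thesis
      using derivative_lie_deriv[OF F e] by (simp add: F'_def lie_deriv_def[of "\<lambda>_. frechet_derivative F (at y) u"])
  qed
  have IH: "S p y u v = (if p = 0 then \<omega> u v else 0)" for y u v
    using Suc.IH by (simp add: S_def e_def)
  let ?t = "\<lambda>i. \<omega> (lie_deriv (\<lambda>_. u) (e i) y) (lie_deriv (\<lambda>_. v) (e (Suc p - i)) y)"
  \<comment> \<open>The factor \<open>p + 1 = i + (p + 1 - i)\<close> is distributed over the two arguments of each term; in
    each of the two sums it then raises one index by one.\<close>
  have 1: "real (Suc p) * S (Suc p) y u v =
      (\<Sum>i\<le>Suc p. real i * ?t i) + (\<Sum>i\<le>Suc p. real (Suc p - i) * ?t i)"
    unfolding S_def sum_distrib_left sum.distrib[symmetric] distrib_right[symmetric]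
    by (intro sum.cong) (auto simp flip: of_nat_add)
  have 2: "(\<Sum>i\<le>Suc p. real i * ?t i) =
      (\<Sum>i\<le>p. \<omega> (real (Suc i) *\<^sub>R lie_deriv (\<lambda>_. u) (e (Suc i)) y) (lie_deriv (\<lambda>_. v) (e (p - i)) y))"
    by (subst sum.atMost_Suc_shift) (simp add: scaleR_left del: of_nat_Suc)
  have 3: "(\<Sum>i\<le>Suc p. real (Suc p - i) * ?t i) =
      (\<Sum>i\<le>p. \<omega> (lie_deriv (\<lambda>_. u) (e i) y) (real (Suc (p - i)) *\<^sub>R lie_deriv (\<lambda>_. v) (e (Suc (p - i))) y))"
    by (auto simp: scaleR_right Suc_diff_le intro!: sum.cong)
  have dw: "(\<lambda>y. \<omega> (lie_deriv (\<lambda>_. u) (e i) y) (lie_deriv (\<lambda>_. v) (e (p - i)) y)) differentiable at y" for i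
    using FDERIV[OF smooth_has_derivative[OF de] smooth_has_derivative[OF de]]
    unfolding differentiable_def by blast
  have dS: "lie_deriv F (\<lambda>y. S p y u v) y =
      (\<Sum>i\<le>p. lie_deriv F (\<lambda>y. \<omega> (lie_deriv (\<lambda>_. u) (e i) y) (lie_deriv (\<lambda>_. v) (e (p - i)) y)) y)"
    unfolding S_def by (rule lie_deriv_sum) (rule dw)
  have A: "\<omega> (real (Suc i) *\<^sub>R lie_deriv (\<lambda>_. u) (e (Suc i)) y) (lie_deriv (\<lambda>_. v) (e (p - i)) y) +
      \<omega> (lie_deriv (\<lambda>_. u) (e i) y) (real (Suc (p - i)) *\<^sub>R lie_deriv (\<lambda>_. v) (e (Suc (p - i))) y) =
      lie_deriv F (\<lambda>y. \<omega> (lie_deriv (\<lambda>_. u) (e i) y) (lie_deriv (\<lambda>_. v) (e (p - i)) y)) y +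
      \<omega> (lie_deriv (\<lambda>_. F' u) (e i) y) (lie_deriv (\<lambda>_. v) (e (p - i)) y) +
      \<omega> (lie_deriv (\<lambda>_. u) (e i) y) (lie_deriv (\<lambda>_. F' v) (e (p - i)) y)" for i
    unfolding step lie_deriv_bilinear[OF \<omega> de[THEN smooth_differentiable] de[THEN smooth_differentiable]]
    by (simp only: add_left add_right)
  have 4: "(\<Sum>i\<le>Suc p. real i * ?t i) + (\<Sum>i\<le>Suc p. real (Suc p - i) * ?t i) =
      lie_deriv F (\<lambda>y. S p y u v) y + S p y (F' u) v + S p y u (F' v)"
    unfolding 2 3 dS unfolding S_def sum.distrib[symmetric] A ..
  have "lie_deriv F (\<lambda>y. S p y u v) y + S p y (F' u) v + S p y u (F' v) = 0"
  proof -
    have "\<omega> (F' u) v + \<omega> u (F' v) = 0"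
      using symp unfolding infinitesimally_symplectic_def F'_def by blast
    then show ?thesis unfolding IH lie_deriv_const by simp
  qed
  then have "real (Suc p) * S (Suc p) y u v = 0" using 1 4 by simp
  then have "S (Suc p) y u v = 0" by simp
  then show ?case by (simp add: S_def e_def)
qed

section \<open>The leading term of a symplecticity defect\<close>

text \<open>Here \<open>s\<^sup>i b i s\<close> and \<open>s\<^sup>i b' i s\<close> are the terms of two series whose product under \<open>\<omega>\<close> is \<open>\<omega> u v\<close>, up to terms of order
  \<open>n + 1\<close> from the truncation; \<open>\<Phi>\<close> and \<open>\<Phi>'\<close> differ from the truncated series by \<open>s\<^sup>n g\<close> and
  \<open>s\<^sup>n g'\<close> up to the same order. The coefficient of \<open>s\<^sup>n\<close> in \<open>\<omega> (\<Phi> s) (\<Phi>' s) - \<omega> u v\<close> is therefore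
  \<open>\<omega> g v + \<omega> u g'\<close>, and it must vanish if the difference is \<open>O(s\<^sup>n\<^sup>+\<^sup>1)\<close>. The bound is required only along a
  filter, because it will be known only for a sequence of step sizes.\<close>

lemma leading_defect_vanishes:
  fixes \<omega> :: "'v::real_normed_vector \<Rightarrow> 'v \<Rightarrow> real" and b b' :: "nat \<Rightarrow> real \<Rightarrow> 'v"
  assumes \<omega>: "bounded_bilinear \<omega>"
    and F: "F \<noteq> bot" "((\<lambda>s. s) \<longlongrightarrow> (0::real)) F" "\<forall>\<^sub>F s in F. 0 < s" and n: "1 \<le> n"
    and cont: "\<And>i. isCont (b i) 0" "\<And>i. isCont (b' i) 0" "isCont \<Phi> 0" "isCont \<Phi>' 0" "isCont r 0" "isCont r' 0"
    and start: "\<Phi> 0 = u" "\<Phi>' 0 = v"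
    and exps: "\<And>s. (\<Sum>i\<le>n. s ^ i *\<^sub>R b i s) = \<Phi> s - s ^ n *\<^sub>R g + s ^ Suc n *\<^sub>R r s"
      "\<And>s. (\<Sum>i\<le>n. s ^ i *\<^sub>R b' i s) = \<Phi>' s - s ^ n *\<^sub>R g' + s ^ Suc n *\<^sub>R r' s"
    and conv: "\<And>s p. (\<Sum>i\<le>p. \<omega> (s ^ i *\<^sub>R b i s) (s ^ (p - i) *\<^sub>R b' (p - i) s)) = (if p = 0 then \<omega> u v else 0)"
    and bound: "\<forall>\<^sub>F s in F. \<bar>\<omega> (\<Phi> s) (\<Phi>' s) - \<omega> u v\<bar> \<le> C * s ^ Suc n"
  shows "\<omega> g v + \<omega> u g' = 0"
proof -
  interpret bounded_bilinear \<omega> by fact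
  define T where "T = (\<lambda>s. \<Sum>(i, j)\<in>{(i, j) \<in> {..n} \<times> {..n}. n < i + j}. s ^ (i + j - n) * \<omega> (b i s) (b' j s))"
  define R where "R = (\<lambda>s. s *\<^sub>R r s - g)"
  define R' where "R' = (\<lambda>s. s *\<^sub>R r' s - g')"
  \<comment> \<open>\<open>Q s\<close> is the defect of \<open>\<Phi>\<close> divided by \<open>s\<^sup>n\<close>, written as a continuous function of \<open>s\<close>, and \<open>T\<close> collects
    the products that the truncation leaves over.\<close>
  define Q where "Q = (\<lambda>s. T s - \<omega> (\<Phi> s) (R' s) - \<omega> (R s) (\<Phi>' s + s ^ n *\<^sub>R R' s))"
  have fin: "finite {(i, j). i + j \<le> n}" "finite {(i, j) \<in> {..n} \<times> {..n}. n < i + j}"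
    by (rule finite_subset[of _ "{..n} \<times> {..n}"]; auto)+
  have prod: "\<omega> (\<Sum>i\<le>n. s ^ i *\<^sub>R b i s) (\<Sum>i\<le>n. s ^ i *\<^sub>R b' i s) = \<omega> u v + s ^ n * T s" for s
  proof -
    let ?w = "\<lambda>(i, j). \<omega> (s ^ i *\<^sub>R b i s) (s ^ j *\<^sub>R b' j s)"
    have "\<omega> (\<Sum>i\<le>n. s ^ i *\<^sub>R b i s) (\<Sum>i\<le>n. s ^ i *\<^sub>R b' i s) = sum ?w ({..n} \<times> {..n})"
      unfolding sum_left unfolding sum_right by (simp add: sum.cartesian_product)
    also have "\<dots> = sum ?w ({(i, j). i + j \<le> n} \<union> {(i, j) \<in> {..n} \<times> {..n}. n < i + j})"
      by (rule sum.cong) auto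
    also have "\<dots> = sum ?w {(i, j). i + j \<le> n} + sum ?w {(i, j) \<in> {..n} \<times> {..n}. n < i + j}"
      by (rule sum.union_disjoint[OF fin]) auto
    finally have "\<omega> (\<Sum>i\<le>n. s ^ i *\<^sub>R b i s) (\<Sum>i\<le>n. s ^ i *\<^sub>R b' i s) =
        sum ?w {(i, j). i + j \<le> n} + sum ?w {(i, j) \<in> {..n} \<times> {..n}. n < i + j}" .
    moreover have "sum ?w {(i, j). i + j \<le> n} = \<omega> u v"
      unfolding sum.triangle_reindex_eq conv by simp
    moreover have "sum ?w {(i, j) \<in> {..n} \<times> {..n}. n < i + j} = s ^ n * T s"
      unfolding T_def sum_distrib_left
    proof (intro sum.cong refl, safe)
      fix i j assume "n < i + j"
      then have "s ^ i * s ^ j = s ^ n * s ^ (i + j - n)" by (simp flip: power_add)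
      moreover have "\<omega> (s ^ i *\<^sub>R b i s) (s ^ j *\<^sub>R b' j s) = (s ^ i * s ^ j) * \<omega> (b i s) (b' j s)"
        by (simp add: scaleR_left scaleR_right)
      ultimately show "\<omega> (s ^ i *\<^sub>R b i s) (s ^ j *\<^sub>R b' j s) = s ^ n * (s ^ (i + j - n) * \<omega> (b i s) (b' j s))"
        by (simp only: mult.assoc)
    qed
    ultimately show ?thesis by simp
  qed
  have Q: "\<omega> (\<Phi> s) (\<Phi>' s) - \<omega> u v = s ^ n * Q s" for s
  proof -
    have "(\<Sum>i\<le>n. s ^ i *\<^sub>R b i s) = \<Phi> s + s ^ n *\<^sub>R R s"
      "(\<Sum>i\<le>n. s ^ i *\<^sub>R b' i s) = \<Phi>' s + s ^ n *\<^sub>R R' s"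
      unfolding exps R_def R'_def by (simp_all add: scaleR_diff_right mult.commute)
    then have "\<omega> u v + s ^ n * T s = \<omega> (\<Phi> s + s ^ n *\<^sub>R R s) (\<Phi>' s + s ^ n *\<^sub>R R' s)"
      using prod[of s] by simp
    also have "\<dots> = \<omega> (\<Phi> s) (\<Phi>' s) + s ^ n * \<omega> (\<Phi> s) (R' s) + s ^ n * \<omega> (R s) (\<Phi>' s + s ^ n *\<^sub>R R' s)"
      by (simp only: add_left[of "\<Phi> s"] add_right[of "\<Phi> s"] scaleR_left scaleR_right real_scaleR_def)
    finally show ?thesis
      unfolding Q_def right_diff_distrib by linarith
  qed
  have "isCont T 0"
    unfolding T_def split_beta by (intro continuous_intros isCont cont)
  have "isCont Q 0"
    unfolding Q_def R_def R'_def by (intro continuous_intros isCont cont \<open>isCont T 0\<close>)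
  have "T 0 = 0"
    unfolding T_def by (rule sum.neutral) (auto simp: power_0_left)
  then have Q0: "Q 0 = \<omega> g v + \<omega> u g'"
    using n by (simp add: Q_def R_def R'_def start minus_left minus_right power_0_left)
  have lim: "(Q \<longlongrightarrow> Q 0) F"
    by (rule isCont_tendsto_compose[OF \<open>isCont Q 0\<close> F(2)])
  have "(Q \<longlongrightarrow> 0) F"
  proof (rule Lim_null_comparison)
    show "\<forall>\<^sub>F s in F. norm (Q s) \<le> C * s"
      using bound F(3)
    proof eventually_elim
      case (elim s)
      then have "s ^ n * \<bar>Q s\<bar> \<le> s ^ n * (C * s)"
        unfolding Q by (simp add: abs_mult mult_ac)
      then show ?case using elim by simp
    qed
    show "((\<lambda>s. C * s) \<longlongrightarrow> 0) F"
      by (rule tendsto_mult_right_zero[OF F(2)])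
  qed
  then have "Q 0 = 0" using lim F(1) tendsto_unique by blast
  with Q0 show ?thesis by simp
qed

section \<open>Words of Lie derivatives and the modified equation\<close>

text \<open>The composition \<open>D\<^bsub>k\<^sub>1\<^esub> \<dots> D\<^bsub>k\<^sub>i\<^esub> id\<close>. As \<open>D\<^sub>k id = f\<^sub>k\<close>, it is the composition
  \<open>D\<^bsub>k\<^sub>1\<^esub> \<dots> D\<^bsub>k\<^sub>i\<^sub>-\<^sub>1\<^esub> f\<^bsub>k\<^sub>i\<^esub>\<close> of the recursion for the modified equation; starting from the identity gives words of
  all lengths a uniform recursion.\<close>

abbreviation word_field :: "('k \<Rightarrow> 'v \<Rightarrow> 'v) \<Rightarrow> 'k list \<Rightarrow> 'v \<Rightarrow> 'v::euclidean_space" where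
  "word_field f ks \<equiv> foldr (\<lambda>k. lie_deriv (f k)) ks (\<lambda>y. y)"

lemma smooth_foldr_lie_deriv:
  "(\<And>k. k \<in> set ks \<Longrightarrow> smooth (f k)) \<Longrightarrow> smooth g \<Longrightarrow> smooth (foldr (\<lambda>k. lie_deriv (f k)) ks g)"
  by (induction ks) (auto intro: smooth_lie_deriv)

lemma word_field_nonempty:
  "ks \<noteq> [] \<Longrightarrow> word_field f ks = foldr (\<lambda>k. lie_deriv (f k)) (butlast ks) (f (last ks))"
  by (induction ks rule: rev_induct) (simp_all add: lie_deriv_ident)

lemma lie_deriv_linear_combination:
  assumes "g differentiable at y"
  shows "lie_deriv (\<lambda>y. \<Sum>k\<in>B. c k *\<^sub>R f k y) g y = (\<Sum>k\<in>B. c k *\<^sub>R lie_deriv (f k) g y)"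
proof -
  interpret linear "frechet_derivative g (at y)"
    using assms by (rule linear_frechet_derivative)
  show ?thesis by (simp add: lie_deriv_def sum scaleR)
qed

lemma lie_deriv_of_linear_combination:
  assumes "\<And>i. i \<in> I \<Longrightarrow> smooth (g i)"
  shows "lie_deriv h (\<lambda>y. \<Sum>i\<in>I. c i *\<^sub>R g i y) y = (\<Sum>i\<in>I. c i *\<^sub>R lie_deriv h (g i) y)"
proof -
  have "lie_deriv h (\<lambda>y. \<Sum>i\<in>I. c i *\<^sub>R g i y) y = (\<Sum>i\<in>I. lie_deriv h (\<lambda>y. c i *\<^sub>R g i y) y)"
    by (intro lie_deriv_sum smooth_differentiable smooth_scaleR smooth_const assms)
  also have "\<dots> = (\<Sum>i\<in>I. c i *\<^sub>R lie_deriv h (g i) y)"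
    by (intro sum.cong refl lie_deriv_scaleR smooth_differentiable assms)
  finally show ?thesis .
qed

lemma infinitesimally_symplectic_linear_combination:
  assumes \<omega>: "bounded_bilinear \<omega>" and "\<And>k. k \<in> B \<Longrightarrow> smooth (f k)"
    and "\<And>k. k \<in> B \<Longrightarrow> infinitesimally_symplectic \<omega> (f k)"
  shows "infinitesimally_symplectic \<omega> (\<lambda>y. \<Sum>k\<in>B. c k *\<^sub>R f k y)"
proof -
  interpret bounded_bilinear \<omega> by fact
  have D: "frechet_derivative (\<lambda>y. \<Sum>k\<in>B. c k *\<^sub>R f k y) (at y) u =
      (\<Sum>k\<in>B. c k *\<^sub>R frechet_derivative (f k) (at y) u)" for y u
    using lie_deriv_of_linear_combination[of B f "\<lambda>_. u"] assms(2) by (simp add: lie_deriv_def)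
  have "\<omega> (\<Sum>k\<in>B. c k *\<^sub>R frechet_derivative (f k) (at y) u) v +
      \<omega> u (\<Sum>k\<in>B. c k *\<^sub>R frechet_derivative (f k) (at y) v) =
      (\<Sum>k\<in>B. c k * (\<omega> (frechet_derivative (f k) (at y) u) v + \<omega> u (frechet_derivative (f k) (at y) v)))" for y u v
    by (simp add: sum_left sum_right scaleR_left scaleR_right distrib_left sum.distrib)
  also have "\<dots> y u v = 0" for y u v
    using assms(3) by (intro sum.neutral) (simp add: infinitesimally_symplectic_def)
  finally show ?thesis
    unfolding infinitesimally_symplectic_def D by simp
qed

text \<open>The multinomial expansion of a power of \<open>\<Sum> c\<^sub>k L\<^bsub>f\<^sub>k\<^esub>\<close>; since the operators do not commute, it runs over words.\<close>

lemma lie_power_linear_combination: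
  assumes B: "finite B" and f: "\<And>k. k \<in> B \<Longrightarrow> smooth (f k)"
  shows "(lie_deriv (\<lambda>y. \<Sum>k\<in>B. c k *\<^sub>R f k y) ^^ i) (\<lambda>y. y) =
    (\<lambda>y. \<Sum>ks | set ks \<subseteq> B \<and> length ks = i. prod_list (map c ks) *\<^sub>R word_field f ks y)"
proof (induction i)
  case 0
  have "{ks. set ks \<subseteq> B \<and> length ks = 0} = {[]}" by auto
  then show ?case by simp
next
  case (Suc i)
  let ?F = "\<lambda>y. \<Sum>k\<in>B. c k *\<^sub>R f k y" and ?L = "{ks. set ks \<subseteq> B \<and> length ks = i}"
  have sm: "smooth (word_field f ks)" if "ks \<in> ?L" for ks
    using that f by (intro smooth_foldr_lie_deriv smooth_id) auto
  show ?case
  proof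
    fix y
    have "(lie_deriv ?F ^^ Suc i) (\<lambda>y. y) y =
        lie_deriv ?F (\<lambda>y. \<Sum>ks\<in>?L. prod_list (map c ks) *\<^sub>R word_field f ks y) y"
      by (simp add: Suc.IH)
    also have "\<dots> = (\<Sum>ks\<in>?L. prod_list (map c ks) *\<^sub>R lie_deriv ?F (word_field f ks) y)"
      using sm by (rule lie_deriv_of_linear_combination)
    also have "\<dots> = (\<Sum>ks\<in>?L. \<Sum>k\<in>B. prod_list (map c (k # ks)) *\<^sub>R word_field f (k # ks) y)"
      using sm[THEN smooth_differentiable]
      by (intro sum.cong refl)
         (simp add: lie_deriv_linear_combination scaleR_sum_right mult.commute)
    also have "\<dots> = (\<Sum>(ks, k)\<in>?L \<times> B. prod_list (map c (k # ks)) *\<^sub>R word_field f (k # ks) y)"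
      by (rule sum.cartesian_product)
    also have "\<dots> = (\<Sum>ks | set ks \<subseteq> B \<and> length ks = Suc i. prod_list (map c ks) *\<^sub>R word_field f ks y)"
      unfolding lists_length_Suc_eq
      by (subst sum.reindex) (auto simp: inj_on_def split_beta intro!: sum.cong)
    finally show "(lie_deriv ?F ^^ Suc i) (\<lambda>y. y) y =
      (\<Sum>ks | set ks \<subseteq> B \<and> length ks = Suc i. prod_list (map c ks) *\<^sub>R word_field f ks y)" .
  qed
qed

lemma smooth_modified_coeff:
  assumes d: "\<And>\<alpha>. 1 \<le> mdeg \<alpha> \<Longrightarrow> smooth (d \<alpha>)" and "1 \<le> mdeg \<alpha>"
  shows "smooth (modified_coeff d \<alpha>)"
  using assms(2)
proof (induction "mdeg \<alpha>" arbitrary: \<alpha> rule: less_induct)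
  case less
  have sm: "smooth (modified_coeff d k)" if "ks \<in> msplits i \<alpha>" "2 \<le> i" "k \<in> set ks" for i ks k
  proof (rule less.hyps)
    show "mdeg k < mdeg \<alpha>" using that by (intro mdeg_less_msplits[of ks i \<alpha>])
    show "1 \<le> mdeg k" using that by (auto simp: msplits_def)
  qed
  have "smooth (foldr (\<lambda>k. lie_deriv (modified_coeff d k)) (butlast ks) (modified_coeff d (last ks)))"
    if "ks \<in> msplits i \<alpha>" "2 \<le> i" for i ks
  proof (rule smooth_foldr_lie_deriv)
    have "ks \<noteq> []" using that by (auto simp: msplits_def)
    then show "smooth (modified_coeff d (last ks))" using sm[OF that] by simp
  qed (use sm[OF that] in_set_butlastD in fastforce)
  then show ?case
    unfolding modified_coeff.simps[of d \<alpha>]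
    by (intro smooth_diff d less.prems smooth_sum smooth_scaleR smooth_const) auto
qed

definition msum :: "'d multi_index list \<Rightarrow> 'd::finite multi_index" where
  "msum ks = (\<lambda>j. \<Sum>k\<leftarrow>ks. k j)"

lemma mdeg_msum: "mdeg (msum ks) = (\<Sum>k\<leftarrow>ks. mdeg k)"
  by (induction ks) (simp_all add: msum_def mdeg_def sum.distrib)

lemma mpow_add: "mpow h x (\<lambda>j. \<alpha> j + \<beta> j) = mpow h x \<alpha> * mpow h x \<beta>"
  by (simp add: mpow_def power_add prod.distrib)

lemma mpow_msum: "mpow h x (msum ks) = prod_list (map (mpow h x) ks)"
proof (induction ks)
  case Nil
  show ?case by (simp add: msum_def mpow_def)
next
  case (Cons k ks)
  have "msum (k # ks) = (\<lambda>j. k j + msum ks j)" by (simp add: msum_def)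
  then show ?case using Cons by (simp add: mpow_add)
qed

lemma mpow_scale: "mpow s (s *\<^sub>R x) \<alpha> = s ^ mdeg \<alpha> * mpow 1 x \<alpha>"
proof -
  have "mdeg \<alpha> = \<alpha> None + (\<Sum>l\<in>UNIV. \<alpha> (Some l))"
    by (simp add: mdeg_def UNIV_option_conv sum.reindex)
  then show ?thesis
    by (simp add: mpow_def power_mult_distrib prod.distrib power_add power_sum)
qed

lemma length_le_mdeg_msum:
  "(\<And>k. k \<in> set ks \<Longrightarrow> 1 \<le> mdeg k) \<Longrightarrow> length ks \<le> mdeg (msum ks)"
  unfolding mdeg_msum by (induction ks) force+

lemma msplits_eq_msum: "msplits i \<alpha> = {ks. length ks = i \<and> (\<forall>k\<in>set ks. 1 \<le> mdeg k) \<and> msum ks = \<alpha>}"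
  by (auto simp: msplits_def msum_def)

text \<open>The recursion for \<open>f\<^sub>\<alpha>\<close> solved for \<open>d\<^sub>\<alpha>\<close>: the words of length at least 2 give \<open>d\<^sub>\<alpha> - f\<^sub>\<alpha>\<close>, and the one word of length 1
  restores \<open>f\<^sub>\<alpha>\<close> unless the restriction to letters of degree below \<open>n\<close> excludes it, which happens exactly
  for \<open>|\<alpha>| = n\<close>.\<close>

lemma modified_coeff_word_sum:
  assumes "1 \<le> mdeg \<alpha>" "mdeg \<alpha> \<le> n"
  shows "(\<Sum>i=1..n. (1 / fact i) *\<^sub>R
      (\<Sum>ks | ks \<in> msplits i \<alpha> \<and> (\<forall>k\<in>set ks. mdeg k < n). word_field (modified_coeff d) ks y)) =
    d \<alpha> y - (if mdeg \<alpha> = n then modified_coeff d \<alpha> y else 0)"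
proof -
  let ?t = "\<lambda>i. (1 / fact i) *\<^sub>R
      (\<Sum>ks | ks \<in> msplits i \<alpha> \<and> (\<forall>k\<in>set ks. mdeg k < n). word_field (modified_coeff d) ks y)"
  have len1: "ks \<in> msplits 1 \<alpha> \<longleftrightarrow> ks = [\<alpha>]" for ks
    using assms by (auto simp: msplits_def length_Suc_conv)
  have "{ks. ks \<in> msplits 1 \<alpha> \<and> (\<forall>k\<in>set ks. mdeg k < n)} = (if mdeg \<alpha> = n then {} else {[\<alpha>]})"
    unfolding len1 using assms(2) by auto
  then have t1: "?t 1 = (if mdeg \<alpha> = n then 0 else modified_coeff d \<alpha> y)"
    by (simp add: lie_deriv_ident)
  have "(\<Sum>i=2..n. ?t i) = (\<Sum>i=2..mdeg \<alpha>. ?t i)"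
  proof (rule sum.mono_neutral_right)
    show "\<forall>i\<in>{2..n} - {2..mdeg \<alpha>}. ?t i = 0"
    proof
      fix i assume "i \<in> {2..n} - {2..mdeg \<alpha>}"
      then have "msplits i \<alpha> = {}"
        using length_le_mdeg_msum by (force simp: msplits_eq_msum)
      then show "?t i = 0" by simp
    qed
  qed (use assms in auto)
  also have "\<dots> = (\<Sum>i=2..mdeg \<alpha>. (1 / fact i) *\<^sub>R (\<Sum>ks\<in>msplits i \<alpha>.
      foldr (\<lambda>k. lie_deriv (modified_coeff d k)) (butlast ks) (modified_coeff d (last ks)) y))"
  proof (intro sum.cong refl arg_cong2[where f = scaleR])
    fix i assume i: "i \<in> {2..mdeg \<alpha>}"
    show "{ks. ks \<in> msplits i \<alpha> \<and> (\<forall>k\<in>set ks. mdeg k < n)} = msplits i \<alpha>"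
      using mdeg_less_msplits[of _ i \<alpha>] i assms(2) by fastforce
    fix ks assume "ks \<in> msplits i \<alpha>"
    then have "ks \<noteq> []" using i by (auto simp: msplits_def)
    then show "word_field (modified_coeff d) ks y =
        foldr (\<lambda>k. lie_deriv (modified_coeff d k)) (butlast ks) (modified_coeff d (last ks)) y"
      by (simp add: word_field_nonempty)
  qed
  also have "\<dots> = d \<alpha> y - modified_coeff d \<alpha> y"
    by (subst (2) modified_coeff.simps) simp
  finally have t2: "(\<Sum>i=2..n. ?t i) = d \<alpha> y - modified_coeff d \<alpha> y" .
  have "{1..n} = insert 1 {2..n}" using assms by auto
  then have "(\<Sum>i=1..n. ?t i) = ?t 1 + (\<Sum>i=2..n. ?t i)" by simp
  then show ?thesis unfolding t1 t2 by simp
qed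

text \<open>The words are sorted by their multi-index sum \<open>\<alpha>\<close>. Those with \<open>|\<alpha>| \<le> n\<close> reproduce the expansion of the
  method, except for the missing \<open>f\<^sub>\<alpha>\<close> with \<open>|\<alpha>| = n\<close>; the words of higher degree form a finite remainder.\<close>

lemma truncated_exp_expansion:
  fixes d :: "'d::finite multi_index \<Rightarrow> 'v::euclidean_space \<Rightarrow> 'v" and n :: nat
  assumes d: "\<And>\<alpha>. 1 \<le> mdeg \<alpha> \<Longrightarrow> smooth (d \<alpha>)"
  defines "B \<equiv> {k :: 'd multi_index. 1 \<le> mdeg k \<and> mdeg k < n}"
  shows "(\<Sum>i\<le>n. exp_term (\<lambda>y. \<Sum>k\<in>B. mpow h x k *\<^sub>R modified_coeff d k y) i y) =
    y + (\<Sum>\<alpha> | 1 \<le> mdeg \<alpha> \<and> mdeg \<alpha> \<le> n. mpow h x \<alpha> *\<^sub>R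
          (d \<alpha> y - (if mdeg \<alpha> = n then modified_coeff d \<alpha> y else 0)))
      + (\<Sum>i\<le>n. \<Sum>ks | set ks \<subseteq> B \<and> length ks = i \<and> n < mdeg (msum ks).
          (mpow h x (msum ks) / fact i) *\<^sub>R word_field (modified_coeff d) ks y)"
proof -
  define f where "f = modified_coeff d"
  define W where "W = (\<lambda>ks. mpow h x (msum ks) *\<^sub>R word_field f ks y)"
  define L where "L = (\<lambda>i. {ks. set ks \<subseteq> B \<and> length ks = i})"
  define A where "A = {\<alpha> :: 'd multi_index. 1 \<le> mdeg \<alpha> \<and> mdeg \<alpha> \<le> n}"
  have B: "finite B" unfolding B_def by (rule finite_subset[OF _ finite_mdeg_le[of n]]) auto
  have A: "finite A" unfolding A_def by (rule finite_subset[OF _ finite_mdeg_le[of n]]) auto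
  have L: "finite (L i)" for i unfolding L_def by (rule finite_lists_length_eq[OF B])
  have f: "smooth (f k)" if "k \<in> B" for k
    unfolding f_def using that by (intro smooth_modified_coeff d) (auto simp: B_def)
  let ?lo = "\<lambda>i. {ks \<in> L i. mdeg (msum ks) \<le> n}" and ?hi = "\<lambda>i. {ks \<in> L i. n < mdeg (msum ks)}"
  have "exp_term (\<lambda>y. \<Sum>k\<in>B. mpow h x k *\<^sub>R f k y) i y = (1 / fact i) *\<^sub>R sum W (?lo i) + (1 / fact i) *\<^sub>R sum W (?hi i)" for i
  proof -
    have "exp_term (\<lambda>y. \<Sum>k\<in>B. mpow h x k *\<^sub>R f k y) i y = (1 / fact i) *\<^sub>R sum W (L i)"
      using fun_cong[OF lie_power_linear_combination[where f = f and c = "mpow h x" and i = i, OF B f], of y]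
      by (simp add: exp_term_def W_def L_def mpow_msum)
    also have "sum W (L i) = sum W (?lo i \<union> ?hi i)" by (rule sum.cong) auto
    also have "\<dots> = sum W (?lo i) + sum W (?hi i)" by (rule sum.union_disjoint) (auto simp: L)
    finally show ?thesis by (simp add: scaleR_add_right)
  qed
  then have "(\<Sum>i\<le>n. exp_term (\<lambda>y. \<Sum>k\<in>B. mpow h x k *\<^sub>R f k y) i y) =
      (\<Sum>i\<le>n. (1 / fact i) *\<^sub>R sum W (?lo i)) + (\<Sum>i\<le>n. (1 / fact i) *\<^sub>R sum W (?hi i))"
    by (simp add: sum.distrib)
  moreover have "(\<Sum>i\<le>n. (1 / fact i) *\<^sub>R sum W (?lo i)) =
      y + (\<Sum>\<alpha>\<in>A. mpow h x \<alpha> *\<^sub>R (d \<alpha> y - (if mdeg \<alpha> = n then f \<alpha> y else 0)))"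
  proof -
    have "?lo 0 = {[]}" by (auto simp: L_def msum_def mdeg_def)
    then have lo0: "sum W (?lo 0) = y" by (simp add: W_def mpow_msum)
    let ?M = "\<lambda>i \<alpha>. {ks. ks \<in> msplits i \<alpha> \<and> (\<forall>k\<in>set ks. mdeg k < n)}"
    have lo: "sum W (?lo i) = (\<Sum>\<alpha>\<in>A. mpow h x \<alpha> *\<^sub>R (\<Sum>ks\<in>?M i \<alpha>. word_field f ks y))" if "1 \<le> i" for i
    proof -
      have "msum ` ?lo i \<subseteq> A"
      proof
        fix \<alpha> assume "\<alpha> \<in> msum ` ?lo i"
        then obtain ks where ks: "\<alpha> = msum ks" "set ks \<subseteq> B" "length ks = i" "mdeg (msum ks) \<le> n"
          by (auto simp: L_def)
        then have "i \<le> mdeg \<alpha>" using length_le_mdeg_msum[of ks] by (auto simp: B_def)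
        then show "\<alpha> \<in> A" using ks that by (auto simp: A_def)
      qed
      then have "sum W (?lo i) = (\<Sum>\<alpha>\<in>A. sum W {ks \<in> ?lo i. msum ks = \<alpha>})"
        using L A by (intro sum.group[symmetric]) auto
      also have "\<dots> = (\<Sum>\<alpha>\<in>A. \<Sum>ks\<in>?M i \<alpha>. mpow h x \<alpha> *\<^sub>R word_field f ks y)"
      proof (rule sum.cong[OF refl], rule sum.cong)
        fix \<alpha> assume "\<alpha> \<in> A"
        then show "{ks \<in> ?lo i. msum ks = \<alpha>} = ?M i \<alpha>"
          by (auto simp: L_def B_def A_def msplits_eq_msum subset_iff)
      qed (auto simp: W_def msplits_eq_msum)
      finally show ?thesis by (simp add: scaleR_sum_right)
    qed
    have "{..n} = insert 0 {1..n}" by auto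
    then have "(\<Sum>i\<le>n. (1 / fact i) *\<^sub>R sum W (?lo i)) = y + (\<Sum>i=1..n. (1 / fact i) *\<^sub>R sum W (?lo i))"
      using lo0 by simp
    also have "(\<Sum>i=1..n. (1 / fact i) *\<^sub>R sum W (?lo i)) =
        (\<Sum>i=1..n. \<Sum>\<alpha>\<in>A. mpow h x \<alpha> *\<^sub>R (1 / fact i) *\<^sub>R (\<Sum>ks\<in>?M i \<alpha>. word_field f ks y))"
      by (intro sum.cong refl) (simp add: lo scaleR_sum_right mult.commute)
    also have "\<dots> = (\<Sum>\<alpha>\<in>A. mpow h x \<alpha> *\<^sub>R (\<Sum>i=1..n. (1 / fact i) *\<^sub>R (\<Sum>ks\<in>?M i \<alpha>. word_field f ks y)))"
      by (subst sum.swap) (simp add: scaleR_sum_right)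
    also have "\<dots> = (\<Sum>\<alpha>\<in>A. mpow h x \<alpha> *\<^sub>R (d \<alpha> y - (if mdeg \<alpha> = n then f \<alpha> y else 0)))"
      unfolding f_def
      by (intro sum.cong refl arg_cong2[where f = scaleR] modified_coeff_word_sum) (auto simp: A_def)
    finally show ?thesis .
  qed
  moreover have "(\<Sum>i\<le>n. (1 / fact i) *\<^sub>R sum W (?hi i)) =
      (\<Sum>i\<le>n. \<Sum>ks | set ks \<subseteq> B \<and> length ks = i \<and> n < mdeg (msum ks). (mpow h x (msum ks) / fact i) *\<^sub>R word_field f ks y)"
    by (auto simp: scaleR_sum_right W_def L_def intro!: sum.cong)
  ultimately show ?thesis unfolding f_def A_def by simp
qed

section \<open>Vanishing homogeneous polynomials\<close>

text \<open>Induction on the set of variables: for fixed values of the others, the polynomial in one variable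
  \<open>x l\<close> vanishes identically, hence so does each of its coefficients, which are polynomials in the remaining
  variables.\<close>

lemma monomials_independent:
  fixes c :: "'k \<Rightarrow> real" and e :: "'k \<Rightarrow> 'i \<Rightarrow> nat"
  assumes "finite S" "finite A" "\<And>a b. a \<in> A \<Longrightarrow> b \<in> A \<Longrightarrow> (\<And>l. l \<in> S \<Longrightarrow> e a l = e b l) \<Longrightarrow> a = b"
    and "\<And>x :: 'i \<Rightarrow> real. (\<Sum>a\<in>A. c a * (\<Prod>l\<in>S. x l ^ e a l)) = 0" and "a \<in> A"
  shows "c a = 0"
  using assms
proof (induction S arbitrary: A a rule: finite_induct)
  case empty
  then have "A = {a}" by auto
  with empty.prems show ?case by simp
next
  case (insert l S)
  define N where "N = Max ((\<lambda>a. e a l) ` A)"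
  have N: "(\<lambda>a. e a l) ` A \<subseteq> {..N}"
    using insert.prems(1) by (auto simp: N_def)
  let ?A = "\<lambda>k. {a \<in> A. e a l = k}"
  have "(\<Sum>a\<in>?A (e a l). c a * (\<Prod>l\<in>S. x l ^ e a l)) = 0" for x
  proof -
    have "(\<Sum>k\<le>N. (\<Sum>a\<in>?A k. c a * (\<Prod>l\<in>S. x l ^ e a l)) * y ^ k) = 0" for y
    proof -
      have "(\<Sum>k\<le>N. (\<Sum>a\<in>?A k. c a * (\<Prod>l\<in>S. x l ^ e a l)) * y ^ k) =
          (\<Sum>k\<le>N. \<Sum>a\<in>?A k. c a * (\<Prod>i\<in>insert l S. (x(l := y)) i ^ e a i))"
      proof (intro sum.cong refl, unfold sum_distrib_right, intro sum.cong refl)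
        fix k a assume a: "a \<in> ?A k"
        have "(\<Prod>i\<in>S. (x(l := y)) i ^ e a i) = (\<Prod>l\<in>S. x l ^ e a l)"
          using insert.hyps(2) by (intro prod.cong) auto
        then show "c a * (\<Prod>l\<in>S. x l ^ e a l) * y ^ k = c a * (\<Prod>i\<in>insert l S. (x(l := y)) i ^ e a i)"
          using insert.hyps a by simp
      qed
      also have "\<dots> = (\<Sum>a\<in>A. c a * (\<Prod>i\<in>insert l S. (x(l := y)) i ^ e a i))"
        using N insert.prems(1) by (intro sum.group) auto
      also have "\<dots> = 0" by (rule insert.prems(3))
      finally show ?thesis .
    qed
    then have "\<forall>k\<le>N. (\<Sum>a\<in>?A k. c a * (\<Prod>l\<in>S. x l ^ e a l)) = 0"
      by (subst polyfun_eq_0[symmetric]) simp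
    moreover have "e a l \<le> N" using N insert.prems(4) by auto
    ultimately show ?thesis by blast
  qed
  then show ?case
    using insert.prems(1,4) by (intro insert.IH[of "?A (e a l)"]) (auto intro!: insert.prems(2))
qed

text \<open>Setting the time variable to 1 loses nothing, because among multi-indices of equal degree the time
  exponent is determined by the others.\<close>

lemma homogeneous_coeffs_vanish:
  fixes c :: "'d::finite multi_index \<Rightarrow> real"
  assumes "\<And>x :: real ^ 'd. (\<Sum>\<alpha> | mdeg \<alpha> = n. mpow 1 x \<alpha> * c \<alpha>) = 0" and "mdeg \<alpha> = n"
  shows "c \<alpha> = 0"
proof (rule monomials_independent[where S = UNIV and A = "{\<alpha>. mdeg \<alpha> = n}" and e = "\<lambda>\<alpha> l. \<alpha> (Some l)"])
  show "finite {\<alpha> :: 'd multi_index. mdeg \<alpha> = n}"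
    by (rule finite_subset[OF _ finite_mdeg_le[of n]]) auto
  show "\<alpha> = \<beta>" if "\<alpha> \<in> {\<alpha>. mdeg \<alpha> = n}" "\<beta> \<in> {\<alpha>. mdeg \<alpha> = n}" "\<And>l. l \<in> UNIV \<Longrightarrow> \<alpha> (Some l) = \<beta> (Some l)"
    for \<alpha> \<beta> :: "'d multi_index"
  proof
    have deg: "mdeg \<gamma> = \<gamma> None + (\<Sum>l\<in>UNIV. \<gamma> (Some l))" for \<gamma> :: "'d multi_index"
      by (simp add: mdeg_def UNIV_option_conv sum.reindex)
    have "\<alpha> None = \<beta> None" using that deg[of \<alpha>] deg[of \<beta>] by simp
    then show "\<alpha> j = \<beta> j" for j using that(3) by (cases j) auto
  qed
  show "(\<Sum>\<alpha> | mdeg \<alpha> = n. c \<alpha> * (\<Prod>l\<in>UNIV. x l ^ \<alpha> (Some l))) = 0" for x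
    using assms(1)[of "\<chi> l. x l"] by (simp add: mpow_def mult.commute)
qed (use assms in auto)

section \<open>The defect of the modified equation at degree n\<close>

text \<open>\<open>\<Phi> s u\<close> is the derivative in direction \<open>u\<close> of the truncated expansion of the method at step size \<open>s\<close> and increments
  \<open>s x\<close>. The scaling makes everything a polynomial in the single variable \<open>s\<close>, in which the multi-index
  \<open>\<alpha>\<close> contributes at order \<open>|\<alpha>|\<close>. The Lie series is taken of the field built from the \<open>f\<^sub>\<alpha>\<close> with
  \<open>|\<alpha>| < n\<close> only, which is infinitesimally symplectic by assumption.\<close>

lemma modified_coeff_leading_defect:
  fixes d :: "'d::finite multi_index \<Rightarrow> 'v::euclidean_space \<Rightarrow> 'v" and \<omega> :: "'v \<Rightarrow> 'v \<Rightarrow> real"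
    and x :: "real ^ 'd" and y u v :: 'v
  assumes \<omega>: "bounded_bilinear \<omega>" and n: "1 \<le> n"
    and d: "\<And>\<alpha>. 1 \<le> mdeg \<alpha> \<Longrightarrow> smooth (d \<alpha>)"
    and lower: "\<And>\<alpha>. 1 \<le> mdeg \<alpha> \<Longrightarrow> mdeg \<alpha> < n \<Longrightarrow> infinitesimally_symplectic \<omega> (modified_coeff d \<alpha>)"
    and F: "F \<noteq> bot" "((\<lambda>s. s) \<longlongrightarrow> (0::real)) F" "\<forall>\<^sub>F s in F. 0 < s"
  defines "\<Phi> \<equiv> \<lambda>s u. u + (\<Sum>\<alpha> | 1 \<le> mdeg \<alpha> \<and> mdeg \<alpha> \<le> n. mpow s (s *\<^sub>R x) \<alpha> *\<^sub>R lie_deriv (\<lambda>_. u) (d \<alpha>) y)"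
    and "g \<equiv> \<lambda>u. \<Sum>\<alpha> | mdeg \<alpha> = n. mpow 1 x \<alpha> *\<^sub>R lie_deriv (\<lambda>_. u) (modified_coeff d \<alpha>) y"
  assumes bound: "\<forall>\<^sub>F s in F. \<bar>\<omega> (\<Phi> s u) (\<Phi> s v) - \<omega> u v\<bar> \<le> C * s ^ Suc n"
  shows "\<omega> (g u) v + \<omega> u (g v) = 0"
proof -
  define f where "f = modified_coeff d"
  define B where "B = {k :: 'd multi_index. 1 \<le> mdeg k \<and> mdeg k < n}"
  define A where "A = {\<alpha> :: 'd multi_index. 1 \<le> mdeg \<alpha> \<and> mdeg \<alpha> \<le> n}"
  define E where "E = (\<lambda>s. exp_term (\<lambda>y. \<Sum>k\<in>B. mpow s (s *\<^sub>R x) k *\<^sub>R f k y))"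
  define L where "L = (\<lambda>i. {ks. set ks \<subseteq> B \<and> length ks = i})"
  define Hi where "Hi = (\<lambda>i. {ks. set ks \<subseteq> B \<and> length ks = i \<and> n < mdeg (msum ks)})"
  define W where "W = (\<lambda>u ks. mpow 1 x (msum ks) *\<^sub>R lie_deriv (\<lambda>_. u) (word_field f ks) y)"
  define b where "b = (\<lambda>u i s. (1 / fact i) *\<^sub>R (\<Sum>ks\<in>L i. s ^ (mdeg (msum ks) - i) *\<^sub>R W u ks))"
  define r where "r = (\<lambda>u s. \<Sum>i\<le>n. \<Sum>ks\<in>Hi i. (s ^ (mdeg (msum ks) - Suc n) / fact i) *\<^sub>R W u ks)"
  have B: "finite B" unfolding B_def by (rule finite_subset[OF _ finite_mdeg_le[of n]]) auto
  have A: "finite A" unfolding A_def by (rule finite_subset[OF _ finite_mdeg_le[of n]]) auto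
  have f: "smooth (f k)" if "1 \<le> mdeg k" for k
    unfolding f_def using that by (intro smooth_modified_coeff d)
  have fB: "smooth (f k)" if "k \<in> B" for k
    using f that by (simp add: B_def)
  have word: "smooth (word_field f ks)" if "set ks \<subseteq> B" for ks
    using that fB by (intro smooth_foldr_lie_deriv smooth_id) auto
  have field: "smooth (\<lambda>y. \<Sum>k\<in>B. mpow s (s *\<^sub>R x) k *\<^sub>R f k y)" for s
    by (intro smooth_sum smooth_scaleR smooth_const fB)
  have E: "smooth (E s i)" for s i unfolding E_def by (intro smooth_exp_term field)
  have symp: "infinitesimally_symplectic \<omega> (\<lambda>y. \<Sum>k\<in>B. mpow s (s *\<^sub>R x) k *\<^sub>R f k y)" for s
    using lower by (intro infinitesimally_symplectic_linear_combination \<omega> fB) (auto simp: B_def f_def)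
  \<comment> \<open>A word of length \<open>i\<close> has degree at least \<open>i\<close>, so the power \<open>s\<^sup>i\<close> can be taken out of the \<open>i\<close>-th term.\<close>
  have E_b: "lie_deriv (\<lambda>_. u) (E s i) y = s ^ i *\<^sub>R b u i s" for s u i
  proof -
    have "E s i = (\<lambda>y. (1 / fact i) *\<^sub>R (\<Sum>ks\<in>L i. mpow s (s *\<^sub>R x) (msum ks) *\<^sub>R word_field f ks y))"
      using lie_power_linear_combination[where f = f and c = "mpow s (s *\<^sub>R x)" and i = i, OF B fB]
      by (simp add: E_def exp_term_def L_def mpow_msum)
    moreover have "smooth (\<lambda>y. \<Sum>ks\<in>L i. mpow s (s *\<^sub>R x) (msum ks) *\<^sub>R word_field f ks y)"
      by (intro smooth_sum smooth_scaleR smooth_const word) (auto simp: L_def)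
    moreover have "lie_deriv (\<lambda>_. u) (\<lambda>y. \<Sum>ks\<in>L i. mpow s (s *\<^sub>R x) (msum ks) *\<^sub>R word_field f ks y) y =
        (\<Sum>ks\<in>L i. mpow s (s *\<^sub>R x) (msum ks) *\<^sub>R lie_deriv (\<lambda>_. u) (word_field f ks) y)"
      by (intro lie_deriv_of_linear_combination word) (auto simp: L_def)
    ultimately have "lie_deriv (\<lambda>_. u) (E s i) y = (1 / fact i) *\<^sub>R
        (\<Sum>ks\<in>L i. mpow s (s *\<^sub>R x) (msum ks) *\<^sub>R lie_deriv (\<lambda>_. u) (word_field f ks) y)"
      by (simp add: lie_deriv_scaleR smooth_differentiable)
    also have "(\<Sum>ks\<in>L i. mpow s (s *\<^sub>R x) (msum ks) *\<^sub>R lie_deriv (\<lambda>_. u) (word_field f ks) y) =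
        (\<Sum>ks\<in>L i. s ^ i *\<^sub>R s ^ (mdeg (msum ks) - i) *\<^sub>R W u ks)"
    proof (rule sum.cong[OF refl])
      fix ks assume "ks \<in> L i"
      then have "i \<le> mdeg (msum ks)"
        using length_le_mdeg_msum[of ks] by (auto simp: L_def B_def)
      then have "s ^ mdeg (msum ks) = s ^ i * s ^ (mdeg (msum ks) - i)"
        by (simp flip: power_add)
      then show "mpow s (s *\<^sub>R x) (msum ks) *\<^sub>R lie_deriv (\<lambda>_. u) (word_field f ks) y =
          s ^ i *\<^sub>R s ^ (mdeg (msum ks) - i) *\<^sub>R W u ks"
        by (simp add: mpow_scale W_def)
    qed
    finally show ?thesis by (simp add: b_def scaleR_sum_right mult.commute)
  qed
  have exps: "(\<Sum>i\<le>n. s ^ i *\<^sub>R b u i s) = \<Phi> s u - s ^ n *\<^sub>R g u + s ^ Suc n *\<^sub>R r u s" for s u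
  proof -
    let ?q = "\<lambda>\<alpha> y. d \<alpha> y - (if mdeg \<alpha> = n then f \<alpha> y else 0)"
    let ?P = "\<lambda>y. \<Sum>\<alpha>\<in>A. mpow s (s *\<^sub>R x) \<alpha> *\<^sub>R ?q \<alpha> y"
    let ?R = "\<lambda>i y. \<Sum>ks\<in>Hi i. (mpow s (s *\<^sub>R x) (msum ks) / fact i) *\<^sub>R word_field f ks y"
    have "(\<lambda>y. \<Sum>i\<le>n. E s i y) = (\<lambda>y. y + ?P y + (\<Sum>i\<le>n. ?R i y))"
      using truncated_exp_expansion[where d = d and n = n and h = s and x = "s *\<^sub>R x", OF d] unfolding E_def f_def B_def A_def Hi_def by blast
    then have "lie_deriv (\<lambda>_. u) (\<lambda>y. \<Sum>i\<le>n. E s i y) y =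
        lie_deriv (\<lambda>_. u) (\<lambda>y. y + ?P y + (\<Sum>i\<le>n. ?R i y)) y" by simp
    moreover have "lie_deriv (\<lambda>_. u) (\<lambda>y. \<Sum>i\<le>n. E s i y) y = (\<Sum>i\<le>n. s ^ i *\<^sub>R b u i s)"
      by (simp add: lie_deriv_sum smooth_differentiable E E_b)
    moreover have q: "smooth (?q \<alpha>)" if "\<alpha> \<in> A" for \<alpha>
      using that d f by (cases "mdeg \<alpha> = n") (auto simp: A_def intro!: smooth_diff)
    then have P: "smooth ?P"
      by (intro smooth_sum smooth_scaleR smooth_const)
    have R: "smooth (?R i)" for i
      by (intro smooth_sum smooth_scaleR smooth_const word) (auto simp: Hi_def)
    have "lie_deriv (\<lambda>_. u) (\<lambda>y. y + ?P y + (\<Sum>i\<le>n. ?R i y)) y =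
        u + lie_deriv (\<lambda>_. u) ?P y + (\<Sum>i\<le>n. lie_deriv (\<lambda>_. u) (?R i) y)"
      using P R smooth_add[OF smooth_id P] smooth_sum[OF R]
      by (simp add: lie_deriv_add lie_deriv_sum smooth_differentiable smooth_id lie_deriv_ident)
    moreover have "lie_deriv (\<lambda>_. u) ?P y = (\<Phi> s u - u) - s ^ n *\<^sub>R g u"
    proof -
      have "lie_deriv (\<lambda>_. u) ?P y = (\<Sum>\<alpha>\<in>A. mpow s (s *\<^sub>R x) \<alpha> *\<^sub>R lie_deriv (\<lambda>_. u) (?q \<alpha>) y)"
        by (rule lie_deriv_of_linear_combination) (rule q)
      also have "\<dots> = (\<Sum>\<alpha>\<in>A. mpow s (s *\<^sub>R x) \<alpha> *\<^sub>R lie_deriv (\<lambda>_. u) (d \<alpha>) y -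
          (if mdeg \<alpha> = n then mpow s (s *\<^sub>R x) \<alpha> *\<^sub>R lie_deriv (\<lambda>_. u) (f \<alpha>) y else 0))"
      proof (rule sum.cong[OF refl])
        fix \<alpha> assume "\<alpha> \<in> A"
        then have sm: "smooth (d \<alpha>)" "smooth (f \<alpha>)" using d f by (auto simp: A_def)
        have "lie_deriv (\<lambda>_. u) (\<lambda>y. d \<alpha> y - f \<alpha> y) y = lie_deriv (\<lambda>_. u) (d \<alpha>) y - lie_deriv (\<lambda>_. u) (f \<alpha>) y"
          using frechet_derivative_eqI[OF has_derivative_diff[OF sm[THEN smooth_has_derivative]], of y]
          by (simp add: lie_deriv_def)
        then show "mpow s (s *\<^sub>R x) \<alpha> *\<^sub>R lie_deriv (\<lambda>_. u) (?q \<alpha>) y =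
          mpow s (s *\<^sub>R x) \<alpha> *\<^sub>R lie_deriv (\<lambda>_. u) (d \<alpha>) y -
          (if mdeg \<alpha> = n then mpow s (s *\<^sub>R x) \<alpha> *\<^sub>R lie_deriv (\<lambda>_. u) (f \<alpha>) y else 0)"
          by (simp add: scaleR_diff_right)
      qed
      also have "\<dots> = (\<Sum>\<alpha>\<in>A. mpow s (s *\<^sub>R x) \<alpha> *\<^sub>R lie_deriv (\<lambda>_. u) (d \<alpha>) y) -
          (\<Sum>\<alpha> | mdeg \<alpha> = n. mpow s (s *\<^sub>R x) \<alpha> *\<^sub>R lie_deriv (\<lambda>_. u) (f \<alpha>) y)"
      proof -
        have "{\<alpha> \<in> A. mdeg \<alpha> = n} = {\<alpha>. mdeg \<alpha> = n}" using n by (auto simp: A_def)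
        then show ?thesis by (simp add: sum_subtractf sum.inter_filter[OF A, symmetric])
      qed
      also have "(\<Sum>\<alpha> | mdeg \<alpha> = n. mpow s (s *\<^sub>R x) \<alpha> *\<^sub>R lie_deriv (\<lambda>_. u) (f \<alpha>) y) = s ^ n *\<^sub>R g u"
        by (simp add: g_def scaleR_sum_right mpow_scale f_def)
      finally show ?thesis by (simp add: \<Phi>_def A_def)
    qed
    moreover have "(\<Sum>i\<le>n. lie_deriv (\<lambda>_. u) (?R i) y) = s ^ Suc n *\<^sub>R r u s"
      unfolding r_def scaleR_sum_right
    proof (rule sum.cong[OF refl])
      fix i
      have "lie_deriv (\<lambda>_. u) (?R i) y =
          (\<Sum>ks\<in>Hi i. (mpow s (s *\<^sub>R x) (msum ks) / fact i) *\<^sub>R lie_deriv (\<lambda>_. u) (word_field f ks) y)"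
        by (rule lie_deriv_of_linear_combination) (auto simp: Hi_def intro: word)
      also have "\<dots> = (\<Sum>ks\<in>Hi i. s ^ Suc n *\<^sub>R (s ^ (mdeg (msum ks) - Suc n) / fact i) *\<^sub>R W u ks)"
      proof (rule sum.cong[OF refl])
        fix ks assume "ks \<in> Hi i"
        then have "s ^ mdeg (msum ks) = s ^ Suc n * s ^ (mdeg (msum ks) - Suc n)"
          unfolding power_add[symmetric] by (simp add: Hi_def)
        then show "(mpow s (s *\<^sub>R x) (msum ks) / fact i) *\<^sub>R lie_deriv (\<lambda>_. u) (word_field f ks) y =
            s ^ Suc n *\<^sub>R (s ^ (mdeg (msum ks) - Suc n) / fact i) *\<^sub>R W u ks"
          by (simp add: mpow_scale W_def)
      qed
      finally show "lie_deriv (\<lambda>_. u) (?R i) y =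
          (\<Sum>ks\<in>Hi i. s ^ Suc n *\<^sub>R (s ^ (mdeg (msum ks) - Suc n) / fact i) *\<^sub>R W u ks)" .
    qed
    ultimately show ?thesis by simp
  qed
  show ?thesis
  proof (rule leading_defect_vanishes[OF \<omega> F n, where b = "b u" and b' = "b v" and r = "r u" and r' = "r v"
        and \<Phi> = "\<lambda>s. \<Phi> s u" and \<Phi>' = "\<lambda>s. \<Phi> s v" and C = C])
    show "isCont (b u i) 0" "isCont (b v i) 0" for i
      unfolding b_def by (intro continuous_intros)+
    show "isCont (r u) 0" "isCont (r v) 0"
      unfolding r_def by (intro continuous_intros; simp)+
    show "isCont (\<lambda>s. \<Phi> s u) 0" "isCont (\<lambda>s. \<Phi> s v) 0"
      unfolding \<Phi>_def mpow_scale by (intro continuous_intros)+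
    show "\<Phi> 0 u = u" "\<Phi> 0 v = v"
      unfolding \<Phi>_def mpow_scale by (auto intro!: sum.neutral simp: power_0_left)
    show "(\<Sum>i\<le>p. \<omega> (s ^ i *\<^sub>R b u i s) (s ^ (p - i) *\<^sub>R b v (p - i) s)) = (if p = 0 then \<omega> u v else 0)" for s p
      unfolding E_b[symmetric] E_def by (rule exp_terms_preserve_form[OF \<omega> field symp])
    show "\<forall>\<^sub>F s in F. \<bar>\<omega> (\<Phi> s u) (\<Phi> s v) - \<omega> u v\<bar> \<le> C * s ^ Suc n"
      by (rule bound)
  qed (rule exps)+
qed

section \<open>The symplectic form\<close>

lemma sum_UNIV_sum_type:
  "(\<Sum>i\<in>UNIV. f i) = (\<Sum>a\<in>UNIV. f (Inl a)) + (\<Sum>b\<in>UNIV. f (Inr b))"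
  for f :: "'a::finite + 'b::finite \<Rightarrow> 'c::comm_monoid_add"
  unfolding UNIV_Plus_UNIV[symmetric] by (subst sum.Plus) (auto simp: o_def)

lemma symplectic_J_vec_nth:
  "((symplectic_J :: real ^ ('m::finite + 'm) ^ ('m + 'm)) *v x) $ Inl a = x $ Inr a"
  "((symplectic_J :: real ^ ('m + 'm) ^ ('m + 'm)) *v x) $ Inr a = - x $ Inl a"
  by (simp_all add: matrix_vector_mult_def symplectic_J_def sum_UNIV_sum_type
      if_distrib[of "\<lambda>c. c * _"] cong: if_cong)

lemma symplectic_J_squared: "symplectic_J *v (symplectic_J *v x) = - x"
proof -
  have "(symplectic_J *v (symplectic_J *v x)) $ i = (- x) $ i" for i
    by (cases i) (simp_all add: symplectic_J_vec_nth)
  then show ?thesis by (simp add: vec_eq_iff)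
qed

lemma inner_sum_index: "(x :: real ^ ('m::finite + 'm)) \<bullet> y =
    (\<Sum>a\<in>UNIV. x $ Inl a * y $ Inl a) + (\<Sum>a\<in>UNIV. x $ Inr a * y $ Inr a)"
  by (simp add: inner_vec_def sum_UNIV_sum_type)

lemma symplectic_J_skew: "(symplectic_J *v x) \<bullet> y = - (x \<bullet> (symplectic_J *v y))"
  by (simp add: inner_sum_index symplectic_J_vec_nth sum_negf)

lemma matrix_inv_symplectic_J: "matrix_inv symplectic_J *v (symplectic_J *v x) = x"
proof -
  let ?J = "symplectic_J :: real ^ ('a + 'a) ^ ('a + 'a)"
  have "((?J ** (?J ** ?J)) ** ?J) *v x = mat 1 *v x" "(?J ** (?J ** (?J ** ?J))) *v x = mat 1 *v x" for x
    by (simp_all add: matrix_vector_mul_assoc[symmetric] symplectic_J_squared)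
  then have "(?J ** (?J ** ?J)) ** ?J = mat 1" "?J ** (?J ** (?J ** ?J)) = mat 1"
    by (simp_all add: matrix_eq)
  then have "invertible ?J" unfolding invertible_def by blast
  then have "matrix_inv ?J ** ?J = mat 1"
    unfolding invertible_def matrix_inv_def by (rule someI2_ex) auto
  then show ?thesis by (simp add: matrix_vector_mul_assoc)
qed

definition symplectic_form :: "real ^ ('m + 'm) \<Rightarrow> real ^ ('m::finite + 'm) \<Rightarrow> real" where
  "symplectic_form u v = u \<bullet> (symplectic_J *v v)"

lemma bounded_bilinear_symplectic_form: "bounded_bilinear symplectic_form"
  unfolding bilinear_conv_bounded_bilinear[symmetric] bilinear_def symplectic_form_def
  by (auto intro!: linearI simp: inner_add_left inner_add_right matrix_vector_right_distrib
      matrix_vector_mult_scaleR)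

text \<open>The condition on \<open>f\<close> is that \<open>J f\<close> has a symmetric derivative, so \<open>J f\<close> is a gradient.\<close>

lemma infinitesimally_symplectic_imp_hamiltonian:
  assumes f: "smooth f" and symp: "infinitesimally_symplectic symplectic_form f"
  shows "\<exists>H. hamiltonian_field H f"
proof -
  let ?J = "symplectic_J :: real ^ ('a + 'a) ^ ('a + 'a)"
  have lin: "bounded_linear ((*v) ?J)" by (rule matrix_vector_mul_bounded_linear)
  have D: "frechet_derivative (\<lambda>y. ?J *v f y) (at y) u = ?J *v frechet_derivative f (at y) u" for y u
    by (subst frechet_derivative_eqI[OF bounded_linear.has_derivative[OF lin smooth_has_derivative[OF f]]]) simp
  have "\<exists>H. \<forall>y. GDERIV H y :> ?J *v f y"
  proof (rule symmetric_derivative_imp_gradient)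
    show "smooth (\<lambda>y. ?J *v f y)" by (rule smooth_linear_comp[OF lin f])
    fix y u v
    have "symplectic_form (frechet_derivative f (at y) u) v + symplectic_form u (frechet_derivative f (at y) v) = 0"
      using symp by (simp add: infinitesimally_symplectic_def)
    then show "frechet_derivative (\<lambda>y. ?J *v f y) (at y) u \<bullet> v = u \<bullet> frechet_derivative (\<lambda>y. ?J *v f y) (at y) v"
      unfolding D symplectic_J_skew symplectic_form_def by linarith
  qed
  then obtain H where "GDERIV H y :> ?J *v f y" for y by blast
  then have "hamiltonian_field H f"
    unfolding hamiltonian_field_def by (metis matrix_inv_symplectic_J)
  then show ?thesis by blast
qed

lemma symplectic_form_jacobian:
  assumes "symplectic_at g z"
  shows "symplectic_form (jacobian g (at z) *v u) (jacobian g (at z) *v v) = symplectic_form u v"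
proof -
  let ?B = "jacobian g (at z)"
  have "symplectic_form (?B *v u) (?B *v v) = (u v* transpose ?B) \<bullet> (symplectic_J *v (?B *v v))"
    by (simp add: symplectic_form_def)
  also have "\<dots> = u \<bullet> ((transpose ?B ** symplectic_J ** ?B) *v v)"
    by (simp only: dot_lmul_matrix matrix_vector_mul_assoc matrix_mul_assoc)
  also have "transpose ?B ** symplectic_J ** ?B = symplectic_J"
    using assms by (simp add: symplectic_at_def)
  finally show ?thesis by (simp add: symplectic_form_def)
qed

section \<open>Almost symplectic truncated expansions\<close>

text \<open>The derivative in direction \<open>u\<close>, at the initial value \<open>z\<close>, of the expansion of a one-step map up to degree \<open>n\<close>.\<close>

definition truncated_tangent ::
  "('d::finite multi_index \<Rightarrow> real ^ 'n \<Rightarrow> real ^ 'n::finite) \<Rightarrow> nat \<Rightarrow> real ^ 'n \<Rightarrow> real \<Rightarrow> real ^ 'd \<Rightarrow> real ^ 'n \<Rightarrow> real ^ 'n" where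
  "truncated_tangent d n z h x u =
    u + (\<Sum>\<alpha> | 1 \<le> mdeg \<alpha> \<and> mdeg \<alpha> \<le> n. mpow h x \<alpha> *\<^sub>R lie_deriv (\<lambda>_. u) (d \<alpha>) z)"

lemma continuous_on_truncated_tangent: "continuous_on S (\<lambda>(h, x). truncated_tangent d n z h x u)"
  unfolding truncated_tangent_def mpow_def split_beta by (intro continuous_intros)

text \<open>Where the one-step map is symplectic, its Jacobian preserves the form exactly, and the truncated
  Jacobian, being bounded and close to it, preserves the form up to an error of the same order.\<close>

lemma expansion_almost_preserves_form:
  fixes \<Psi> :: "real \<Rightarrow> real ^ 'd::finite \<Rightarrow> real ^ ('m + 'm) \<Rightarrow> real ^ ('m::finite + 'm)"
  assumes d: "\<And>\<alpha>. 1 \<le> mdeg \<alpha> \<Longrightarrow> smooth (d \<alpha>)" and exp: "has_increment_expansion \<Psi> d"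
  shows "\<exists>C. \<forall>\<^sub>F (h, x) in at (0, 0) within {0<..} \<times> UNIV. symplectic_at (\<Psi> h x) z \<longrightarrow>
    \<bar>symplectic_form (truncated_tangent d n z h x u) (truncated_tangent d n z h x v) - symplectic_form u v\<bar>
      \<le> C * norm (h, x) ^ Suc n"
proof -
  let ?F = "at (0 :: real, 0 :: real ^ 'd) within {0<..} \<times> UNIV"
  define A where "A = (\<lambda>w. mat 1 + (\<Sum>\<alpha> | 1 \<le> mdeg \<alpha> \<and> mdeg \<alpha> \<le> n. mpow (fst w) (snd w) \<alpha> *\<^sub>R jacobian (d \<alpha>) (at z)))"
  define J where "J = (\<lambda>w. jacobian (\<Psi> (fst w) (snd w)) (at z))"
  define \<beta> where "\<beta> = (\<lambda>P Q :: real ^ ('m + 'm) ^ ('m + 'm). symplectic_form (P *v u) (Q *v v))"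
  have "bilinear \<beta>"
    unfolding bilinear_def \<beta>_def symplectic_form_def
    by (auto intro!: linearI simp: inner_add_left inner_add_right matrix_vector_right_distrib
        matrix_vector_mult_scaleR matrix_vector_mult_add_rdistrib scaleR_matrix_vector_assoc[symmetric])
  then interpret \<beta>: bounded_bilinear \<beta> by (simp add: bilinear_conv_bounded_bilinear)
  obtain K where K: "0 < K" "\<And>P Q. norm (\<beta> P Q) \<le> norm P * norm Q * K"
    using \<beta>.pos_bounded by blast
  have A_vec: "A (h, x) *v w = truncated_tangent d n z h x w" for h x w
  proof -
    have "jacobian (d \<alpha>) (at z) *v w = lie_deriv (\<lambda>_. w) (d \<alpha>) z" if "1 \<le> mdeg \<alpha>" for \<alpha>
      using smooth_has_derivative[OF d[OF that], of z]
      by (simp add: jacobian_def lie_deriv_def matrix_works has_derivative_linear)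
    moreover have lin: "linear (\<lambda>P :: real ^ ('m + 'm) ^ ('m + 'm). P *v w)"
      by (auto intro!: linearI simp: matrix_vector_mult_add_rdistrib scaleR_matrix_vector_assoc[symmetric])
    ultimately show ?thesis
      unfolding A_def truncated_tangent_def
      by (simp add: linear_add[OF lin] linear_sum[OF lin] linear_cmul[OF lin])
  qed
  have "isCont A (0, 0)" unfolding A_def mpow_def by (intro continuous_intros)
  then have "(A \<longlongrightarrow> A (0, 0)) ?F" by (simp add: isCont_def tendsto_within_subset[OF _ subset_UNIV])
  then have "((\<lambda>w. norm (A w)) \<longlongrightarrow> norm (A (0, 0))) ?F" by (rule tendsto_norm)
  then have ev_A: "\<forall>\<^sub>F w in ?F. norm (A w) < norm (A (0, 0)) + 1"
    by (rule order_tendstoD) simp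
  have ev_w: "\<forall>\<^sub>F w in ?F. norm w < 1"
    by (rule order_tendstoD(2)[OF tendsto_norm[OF tendsto_ident_at]]) simp
  have "(\<lambda>(h, x). norm (jacobian (\<Psi> h x) (at z) -
      (mat 1 + (\<Sum>\<alpha> | 1 \<le> mdeg \<alpha> \<and> mdeg \<alpha> \<le> n. mpow h x \<alpha> *\<^sub>R jacobian (d \<alpha>) (at z)))))
      \<in> O[?F](\<lambda>w. norm w ^ (n + 1))"
    using exp unfolding has_increment_expansion_def Let_def by blast
  then have "(\<lambda>w. norm (J w - A w)) \<in> O[?F](\<lambda>w. norm w ^ (n + 1))"
    unfolding J_def A_def case_prod_unfold .
  then obtain c where c: "c > 0" "\<forall>\<^sub>F w in ?F. norm (norm (J w - A w)) \<le> c * norm (norm w ^ (n + 1))"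
    by (rule landau_o.bigE)
  define C where "C = c * K * (2 * (norm (A (0, 0)) + 1) + c)"
  have "\<forall>\<^sub>F w in ?F. symplectic_at (\<Psi> (fst w) (snd w)) z \<longrightarrow>
      \<bar>\<beta> (A w) (A w) - symplectic_form u v\<bar> \<le> C * norm w ^ Suc n"
    using c(2) ev_A ev_w
  proof eventually_elim
    case (elim w)
    show ?case
    proof
      assume "symplectic_at (\<Psi> (fst w) (snd w)) z"
      then have "\<beta> (J w) (J w) = symplectic_form u v"
        unfolding \<beta>_def J_def by (rule symplectic_form_jacobian)
      moreover have "\<beta> (A w) (A w) - \<beta> (J w) (J w) = - \<beta> (J w - A w) (A w) - \<beta> (J w) (J w - A w)"
        by (simp add: \<beta>.diff_left \<beta>.diff_right)
      ultimately have "\<bar>\<beta> (A w) (A w) - symplectic_form u v\<bar> \<le> norm (\<beta> (J w - A w) (A w)) + norm (\<beta> (J w) (J w - A w))"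
        by simp
      also have "\<dots> \<le> norm (J w - A w) * norm (A w) * K + norm (J w) * norm (J w - A w) * K"
        by (intro add_mono K)
      also have "\<dots> = K * norm (J w - A w) * (norm (A w) + norm (J w))"
        by (simp add: algebra_simps)
      also have "\<dots> \<le> K * (c * norm w ^ Suc n) * (2 * (norm (A (0, 0)) + 1) + c)"
      proof (intro mult_mono mult_nonneg_nonneg)
        show JA: "norm (J w - A w) \<le> c * norm w ^ Suc n" using elim(1) by simp
        have "norm w ^ Suc n \<le> 1" using elim(3) by (intro power_le_one) auto
        then have "norm (J w - A w) \<le> c" using JA c(1) by (smt (verit) mult_left_le)
        then have "norm (J w) \<le> norm (A w) + c" using norm_triangle_sub[of "J w" "A w"] by simp
        then show "norm (A w) + norm (J w) \<le> 2 * (norm (A (0, 0)) + 1) + c" using elim(2) by simp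
      qed (use K(1) c(1) in auto)
      finally show "\<bar>\<beta> (A w) (A w) - symplectic_form u v\<bar> \<le> C * norm w ^ Suc n"
        by (simp add: C_def mult_ac)
    qed
  qed
  moreover have "A w *v p = truncated_tangent d n z (fst w) (snd w) p" for w p
    using A_vec[of "fst w" "snd w"] by simp
  ultimately show ?thesis
    unfolding \<beta>_def case_prod_unfold prod.collapse by auto
qed

section \<open>Support of the noise increments\<close>

lemma centered_normal_hits_interval:
  assumes Z: "centered_normal M Z" and nz: "\<not> (AE \<omega> in M. Z \<omega> = 0)" and "a < b"
  shows "emeasure M (Z -` {a<..<b} \<inter> space M) \<noteq> 0"
proof
  assume null: "emeasure M (Z -` {a<..<b} \<inter> space M) = 0"
  obtain \<sigma> where \<sigma>: "\<sigma> > 0" "distributed M lborel Z (normal_density 0 \<sigma>)"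
    using Z nz by (auto simp: centered_normal_def)
  have "(\<integral>\<^sup>+x. ennreal (normal_density 0 \<sigma> x) * indicator {a<..<b} x \<partial>lborel) = 0"
    using distributed_emeasure[OF \<sigma>(2), of "{a<..<b}"] null by simp
  then have "AE x in lborel. ennreal (normal_density 0 \<sigma> x) * indicator {a<..<b} x = 0"
    by (subst (asm) nn_integral_0_iff_AE) auto
  then have "AE x in lborel. x \<notin> {a<..<b}"
  proof eventually_elim
    case (elim x)
    then show ?case using normal_density_pos[OF \<sigma>(1), of 0 x] by (auto split: split_indicator_asm)
  qed
  then have "{a<..<b} \<in> null_sets lborel"
    by (subst AE_iff_null_sets) auto
  with \<open>a < b\<close> show False by (simp add: null_sets_def)
qed

text \<open>An open set contains a box, and the components of the increment are independent, so the probability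
  of the box is the product of those of its sides. Each of them is positive, because a normal variable
  that does not vanish almost surely has a positive density.\<close>

lemma increments_hit_open_sets:
  fixes X :: "'d::finite \<Rightarrow> real \<Rightarrow> 'a \<Rightarrow> real"
  assumes noise: "gaussian_noise M T X" and t: "0 < t" "t \<le> T"
    and nondeg: "\<And>l. \<not> (AE \<omega> in M. X l t \<omega> - X l 0 \<omega> = 0)"
    and U: "open U" "U \<noteq> {}"
  shows "\<not> (AE \<omega> in M. noise_increment X 0 t \<omega> \<notin> U)"
proof
  assume AE: "AE \<omega> in M. noise_increment X 0 t \<omega> \<notin> U"
  define Z where "Z = (\<lambda>l \<omega>. X l t \<omega> - X l 0 \<omega>)"
  interpret prob_space M using noise by (simp add: gaussian_noise_def)
  have normal: "centered_normal M (Z l)" for l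
  proof -
    have "centered_normal M (\<lambda>\<omega>. \<Sum>r\<in>{0, t}. (if r = 0 then - 1 else 1) * X l r \<omega>)"
    proof -
      have "centered_gaussian_process M {0..T} (X l)" using noise by (simp add: gaussian_noise_def)
      note this[unfolded centered_gaussian_process_def, rule_format, of "{0, t}" "\<lambda>r. if r = 0 then - 1 else 1"]
      then show ?thesis using t by simp
    qed
    also have "(\<lambda>\<omega>. \<Sum>r\<in>{0, t}. (if r = 0 then - 1 else 1) * X l r \<omega>) = Z l"
      using t by (auto simp: Z_def)
    finally show ?thesis .
  qed
  have "indep_vars (\<lambda>_. borel) (\<lambda>l \<omega>. (\<lambda>s\<in>{0..T}. X l s \<omega>) t - (\<lambda>s\<in>{0..T}. X l s \<omega>) 0) UNIV"
  proof (rule indep_vars_compose2[where M' = "\<lambda>_. \<Pi>\<^sub>M s\<in>{0..T}. borel" and N = "\<lambda>_. borel"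
        and X = "\<lambda>l \<omega>. \<lambda>s\<in>{0..T}. X l s \<omega>" and Y = "\<lambda>_ p. p t - p 0"])
    show "indep_vars (\<lambda>_. \<Pi>\<^sub>M s\<in>{0..T}. borel) (\<lambda>l \<omega>. \<lambda>s\<in>{0..T}. X l s \<omega>) UNIV"
      using noise by (simp add: gaussian_noise_def)
    have "(\<lambda>p. p s :: real) \<in> borel_measurable (\<Pi>\<^sub>M s\<in>{0..T}. borel)" if "s \<in> {0..T}" for s
      using that by (rule measurable_component_singleton)
    from borel_measurable_diff[OF this this, of t 0]
    show "(\<lambda>p. p t - p 0 :: real) \<in> borel_measurable (\<Pi>\<^sub>M s\<in>{0..T}. borel)"
      using t by simp
  qed
  then have indep: "indep_vars (\<lambda>_. borel) Z UNIV"
    using t by (simp add: Z_def)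
  obtain a b p where ab: "p \<in> box a b" "box a b \<subseteq> U"
    using U open_contains_box by (metis all_not_in_conv)
  then have lt: "a $ l < b $ l" for l
    by (metis (no_types) mem_box_cart(1) order.strict_trans)
  have "prob (\<Inter>l\<in>UNIV. Z l -` {a $ l<..<b $ l} \<inter> space M) =
      (\<Prod>l\<in>UNIV. prob (Z l -` {a $ l<..<b $ l} \<inter> space M))"
    by (rule indep_varsD[OF indep]) auto
  also have "\<dots> \<noteq> 0"
  proof -
    have "prob (Z l -` {a $ l<..<b $ l} \<inter> space M) \<noteq> 0" for l
      using centered_normal_hits_interval[OF normal _ lt[of l]] nondeg[of l]
      by (simp add: Z_def emeasure_eq_measure)
    then show ?thesis by simp
  qed
  finally have pos: "prob (\<Inter>l\<in>UNIV. Z l -` {a $ l<..<b $ l} \<inter> space M) \<noteq> 0" .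
  have "AE \<omega> in M. \<omega> \<notin> (\<Inter>l\<in>UNIV. Z l -` {a $ l<..<b $ l} \<inter> space M)"
    using AE
  proof eventually_elim
    case (elim \<omega>)
    then have "noise_increment X 0 t \<omega> \<notin> box a b" using ab by blast
    then show ?case by (auto simp: mem_box_cart noise_increment_def Z_def)
  qed
  moreover have "(\<Inter>l\<in>UNIV. Z l -` {a $ l<..<b $ l} \<inter> space M) \<in> sets M"
  proof (rule sets.finite_INT)
    fix l
    have "Z l \<in> borel_measurable M" using normal[of l] by (simp add: centered_normal_def)
    then show "Z l -` {a $ l<..<b $ l} \<inter> space M \<in> sets M" by (rule measurable_sets) simp
  qed auto
  ultimately have "prob (\<Inter>l\<in>UNIV. Z l -` {a $ l<..<b $ l} \<inter> space M) = 0"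
    by (simp add: prob_eq_0)
  with pos show False by simp
qed

section \<open>Hamiltonian modified equations\<close>

theorem theorem3p2:
  fixes M :: "'a measure" and T :: real
    and X :: "'d::finite \<Rightarrow> real \<Rightarrow> 'a \<Rightarrow> real"
    and H :: "'d option \<Rightarrow> real ^ ('m::finite + 'm) \<Rightarrow> real"
    and V :: "'d option \<Rightarrow> real ^ ('m + 'm) \<Rightarrow> real ^ ('m + 'm)"
    and \<Psi> :: "real \<Rightarrow> real ^ 'd \<Rightarrow> real ^ ('m + 'm) \<Rightarrow> real ^ ('m + 'm)"
    and d :: "'d multi_index \<Rightarrow> real ^ ('m + 'm) \<Rightarrow> real ^ ('m + 'm)"
  assumes T: "0 < T"
    and noise: "gaussian_noise M T X" "nondegenerate_noise M T X"
    and hamiltonian: "\<And>j. hamiltonian_field (H j) (V j)"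
    and V_bounded: "\<And>j. bounded_smooth (V j)"
    and d_smooth: "\<And>\<alpha>. 1 \<le> mdeg \<alpha> \<Longrightarrow> smooth (d \<alpha>)"
    and expansion: "has_increment_expansion \<Psi> d"
    and consistent: "\<And>l. d (munit (Some l)) = V (Some l)"
    and symplectic: "\<And>N z. 1 \<le> N \<Longrightarrow>
      AE \<omega> in M. symplectic_at (\<lambda>y. numerical_solution \<Psi> X (T / real N) 1 y \<omega>) z"
  shows "\<forall>\<alpha>. 1 \<le> mdeg \<alpha> \<longrightarrow> (\<exists>H\<^sub>\<alpha>. hamiltonian_field H\<^sub>\<alpha> (modified_coeff d \<alpha>))"
proof -
  \<comment> \<open>The step sizes at which the noise is nondegenerate. They accumulate at 0, so limits along them
    determine the leading coefficients of polynomials in the step size.\<close>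
  define good where "good = {N :: nat. 1 \<le> N \<and> (\<forall>l. \<not> (AE \<omega> in M. X l (T / real N) \<omega> - X l 0 \<omega> = 0))}"
  define F where "F = at (0 :: real) within (\<lambda>N. T / real N) ` good"
  have pos: "0 < s" if "s \<in> (\<lambda>N. T / real N) ` good" for s
    using that T by (auto simp: good_def)
  have F: "F \<noteq> bot" "((\<lambda>s. s) \<longlongrightarrow> 0) F" "\<forall>\<^sub>F s in F. 0 < s"
  proof -
    have "\<exists>s\<in>(\<lambda>N. T / real N) ` good. s \<noteq> 0 \<and> dist s 0 < e" if "0 < e" for e
    proof -
      have "\<exists>N\<ge>nat \<lceil>T / e\<rceil> + 1. \<forall>l. \<not> (AE \<omega> in M. X l (T / real N) \<omega> - X l 0 \<omega> = 0)"
        using noise(2) unfolding nondegenerate_noise_def INFM_nat_le by blast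
      then obtain N where N: "nat \<lceil>T / e\<rceil> + 1 \<le> N" "\<forall>l. \<not> (AE \<omega> in M. X l (T / real N) \<omega> - X l 0 \<omega> = 0)"
        by blast
      then have "N \<in> good" by (simp add: good_def)
      moreover have "T / e < real N" using N(1) by linarith
      then have "T / real N < e" using \<open>0 < e\<close> N(1) by (simp add: field_simps)
      ultimately show ?thesis using pos T N(1) by (intro bexI[of _ "T / real N"]) auto
    qed
    then show "F \<noteq> bot"
      unfolding F_def by (simp add: trivial_limit_within islimpt_approachable)
    show "((\<lambda>s. s) \<longlongrightarrow> 0) F" unfolding F_def by (rule tendsto_ident_at)
    show "\<forall>\<^sub>F s in F. 0 < s" unfolding F_def eventually_at_filter using pos by (simp add: always_eventually)
  qed
  have bound: "\<exists>C. \<forall>\<^sub>F s in F.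
      \<bar>symplectic_form (truncated_tangent d n z s (s *\<^sub>R x) u) (truncated_tangent d n z s (s *\<^sub>R x) v)
        - symplectic_form u v\<bar> \<le> C * s ^ Suc n" for n z u v and x :: "real ^ 'd"
  proof -
    define defect where "defect = (\<lambda>(h, x). \<bar>symplectic_form (truncated_tangent d n z h x u)
      (truncated_tangent d n z h x v) - symplectic_form u v\<bar>)"
    obtain C where "\<forall>\<^sub>F (h, x) in at (0, 0) within {0<..} \<times> UNIV. symplectic_at (\<Psi> h x) z \<longrightarrow>
        defect (h, x) \<le> C * norm (h, x) ^ Suc n"
      using expansion_almost_preserves_form[OF d_smooth expansion, where z = z and u = u and v = v and n = n]
      unfolding defect_def by auto
    then obtain \<delta> where \<delta>: "0 < \<delta>" "\<And>h x. 0 < h \<Longrightarrow> norm (h, x) < \<delta> \<Longrightarrow> symplectic_at (\<Psi> h x) z \<Longrightarrow>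
        defect (h, x) \<le> C * norm (h, x) ^ Suc n"
      unfolding eventually_at by (force simp: dist_norm)
    have cont: "continuous_on UNIV defect"
    proof -
      note bounded_bilinear.continuous_on[OF bounded_bilinear_symplectic_form, continuous_intros]
      note continuous_on_truncated_tangent[unfolded case_prod_unfold, continuous_intros]
      show ?thesis unfolding defect_def case_prod_unfold by (intro continuous_intros)
    qed
    \<comment> \<open>Symplecticity gives the bound only at almost all values of the increment. As both sides are
      continuous in \<open>x\<close>, a violation would occur on an open set, which the increment hits.\<close>
    have all_x: "defect (h, x) \<le> C * norm (h, x) ^ Suc n"
      if h: "h \<in> (\<lambda>N. T / real N) ` good" and small: "norm (h, x) < \<delta>" for h x
    proof (rule ccontr)
      assume contra: "\<not> defect (h, x) \<le> C * norm (h, x) ^ Suc n"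
      obtain N where N: "N \<in> good" "h = T / real N" using h by auto
      define U where "U = {x. norm (h, x) < \<delta>} \<inter> {x. C * norm (h, x) ^ Suc n < defect (h, x)}"
      have "continuous_on UNIV (\<lambda>x. defect (h, x))"
        by (rule continuous_on_compose2[OF cont]) (auto intro!: continuous_intros)
      then have "open U" unfolding U_def
        by (intro open_Int open_Collect_less continuous_intros)
      moreover have "U \<noteq> {}" using contra small by (auto simp: U_def)
      moreover have "0 < h" using h by (rule pos)
      moreover have "h \<le> T" "\<And>l. \<not> (AE \<omega> in M. X l h \<omega> - X l 0 \<omega> = 0)"
        using N T divide_left_mono[of 1 "real N" T] by (auto simp: good_def)
      ultimately have hit: "\<not> (AE \<omega> in M. noise_increment X 0 h \<omega> \<notin> U)"
        by (intro increments_hit_open_sets[OF noise(1)])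
      have "AE \<omega> in M. symplectic_at (\<Psi> h (noise_increment X 0 h \<omega>)) z"
        using symplectic[of N z] N by (simp add: good_def)
      then have "AE \<omega> in M. noise_increment X 0 h \<omega> \<notin> U"
      proof eventually_elim
        case (elim \<omega>)
        then show ?case using \<delta>(2)[OF \<open>0 < h\<close>] by (force simp: U_def)
      qed
      with hit show False by blast
    qed
    have norm_s: "norm (s, s *\<^sub>R x) = s * norm (1 :: real, x)" if "0 < s" for s :: real
    proof -
      have "(s, s *\<^sub>R x) = s *\<^sub>R (1, x)" by simp
      then show ?thesis using that by (simp only: norm_scaleR real_norm_def abs_of_pos)
    qed
    have "((\<lambda>s. s * norm (1 :: real, x)) \<longlongrightarrow> 0) F"
      by (rule tendsto_mult_left_zero[OF F(2)])
    then have "\<forall>\<^sub>F s in F. s * norm (1 :: real, x) < \<delta>" using \<delta>(1) by (rule order_tendstoD)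
    moreover have "\<forall>\<^sub>F s in F. s \<in> (\<lambda>N. T / real N) ` good"
      unfolding F_def eventually_at_filter by (simp add: always_eventually)
    ultimately have "\<forall>\<^sub>F s in F. defect (s, s *\<^sub>R x) \<le> (C * norm (1 :: real, x) ^ Suc n) * s ^ Suc n"
    proof eventually_elim
      case (elim s)
      then show ?case
        using all_x[of s "s *\<^sub>R x"] pos[of s] norm_s[of s] by (simp add: power_mult_distrib mult_ac)
    qed
    then show ?thesis unfolding defect_def by auto
  qed
  have symp: "infinitesimally_symplectic symplectic_form (modified_coeff d \<alpha>)" if "1 \<le> mdeg \<alpha>" for \<alpha>
    using that
  proof (induction "mdeg \<alpha>" arbitrary: \<alpha> rule: less_induct)
    case less
    interpret bounded_bilinear symplectic_form by (rule bounded_bilinear_symplectic_form)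
    show ?case
      unfolding infinitesimally_symplectic_def
    proof (intro allI)
      fix y u v
      define c where "c = (\<lambda>\<beta>. symplectic_form (lie_deriv (\<lambda>_. u) (modified_coeff d \<beta>) y) v +
        symplectic_form u (lie_deriv (\<lambda>_. v) (modified_coeff d \<beta>) y))"
      have "(\<Sum>\<beta> | mdeg \<beta> = mdeg \<alpha>. mpow 1 x \<beta> * c \<beta>) = 0" for x :: "real ^ 'd"
      proof -
        let ?g = "\<lambda>u. \<Sum>\<beta> | mdeg \<beta> = mdeg \<alpha>. mpow 1 x \<beta> *\<^sub>R lie_deriv (\<lambda>_. u) (modified_coeff d \<beta>) y"
        obtain C where C: "\<forall>\<^sub>F s in F. \<bar>symplectic_form (truncated_tangent d (mdeg \<alpha>) y s (s *\<^sub>R x) u)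
            (truncated_tangent d (mdeg \<alpha>) y s (s *\<^sub>R x) v) - symplectic_form u v\<bar> \<le> C * s ^ Suc (mdeg \<alpha>)"
          using bound by blast
        have "symplectic_form (?g u) v + symplectic_form u (?g v) = 0"
        proof (rule modified_coeff_leading_defect[OF bounded_bilinear_symplectic_form less.prems d_smooth _ F])
          show "infinitesimally_symplectic symplectic_form (modified_coeff d \<beta>)"
            if "1 \<le> mdeg \<beta>" "mdeg \<beta> < mdeg \<alpha>" for \<beta>
            using less.hyps that by blast
        qed (use C in \<open>simp_all add: truncated_tangent_def\<close>)
        then show ?thesis
          by (simp add: c_def sum_left sum_right scaleR_left scaleR_right distrib_left sum.distrib)
      qed
      then have "c \<alpha> = 0" by (rule homogeneous_coeffs_vanish) simp
      then show "symplectic_form (frechet_derivative (modified_coeff d \<alpha>) (at y) u) v +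
          symplectic_form u (frechet_derivative (modified_coeff d \<alpha>) (at y) v) = 0"
        by (simp add: c_def lie_deriv_def)
    qed
  qed
  show ?thesis
    by (intro allI impI infinitesimally_symplectic_imp_hamiltonian smooth_modified_coeff d_smooth symp)
qed

end
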